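(* Let $d\ge 1$, let $\mathfrak{m}=(c_0,C,\tilde C,U)\in\mathfrak{M}_d$ with $C=\mathrm{diag}(1,-c_1,\dots,-c_d)$ and $\tilde C=\mathrm{diag}(1,-\tilde c_1,\dots,-\tilde c_d)$, and let $\beta\in\mathbb{C}\setminus(-\mathbb{N}_0)$. Suppose that $|c_1|+|c_2|+\cdots+|c_d|<1$ (absolute values of complex numbers). Then for all $n,m\in\mathbb{N}_0^d$, $$\sum_{x\in\mathbb{N}_0^d}P_n(x;\mathfrak{m},\beta)\,P_m(x;\mathfrak{m},\beta)\,\frac{(\beta)_{|x|}}{x!}\,c^x=\frac{c_0^{-\beta}\,n!}{(\beta)_{|n|}\,\tilde c^{\,n}}\,\delta_{n,m},$$ where $c=(c_1,\dots,c_d)$ and $\tilde c=(\tilde c_1,\dots,\tilde c_d)$.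
   Context: Notation: $\mathbb{N}_0=\{0,1,2,\dots\}$ and $-\mathbb{N}_0=\{0,-1,-2,\dots\}$. For vectors $x\in\mathbb{C}^d$, $n\in\mathbb{N}_0^d$: $x^n=x_1^{n_1}\cdots x_d^{n_d}$, $n!=n_1!\cdots n_d!$, and $|x|=x_1+\cdots+x_d$ (sum of the coordinates, without absolute values). $(a)_k=a(a+1)\cdots(a+k-1)$, $(a)_0=1$, is the Pochhammer symbol. $\delta_{n,m}$ is $1$ if $n=m$ and $0$ otherwise. Complex powers are taken with the principal branch of the logarithm. The set $\mathfrak{M}_d$: it consists of all 4-tuples $\mathfrak{m}=(c_0,C,\tilde C,U)$, where $c_0$ is a nonzero complex number and $C,\tilde C,U$ are complex $(d+1)\times(d+1)$ matrices (rows and columns indexed by $0,1,\dots,d$) such that (i) $C=\mathrm{diag}(1,-c_1,\dots,-c_d)$ and $\tilde C=\mathrm{diag}(1,-\tilde c_1,\dots,-\tilde c_d)$ are diagonal; (ii) $U=(u_{i,j})_{0\le i,j\le d}$ satisfies $u_{0,j}=u_{j,0}=1$ for all $j=0,1,\dots,d$; (iii) $U^{t}CU\tilde C=c_0I_{d+1}$, where $I_{d+1}$ is the identity matrix. (In particular $C,\tilde C,U$ are invertible, so all $c_j,\tilde c_j$ are nonzero.) Multivariate Meixner polynomials: for $\mathfrak{m}\in\mathfrak{M}_d$ and $\beta\in\mathbb{C}\setminus(-\mathbb{N}_0)$, the polynomials $P_n(x;\mathfrak{m},\beta)$ in $x=(x_1,\dots,x_d)$, $n\in\mathbb{N}_0^d$,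 are defined by the expansion, for $z=(z_1,\dots,z_d)$ in a neighborhood of $0$ in $\mathbb{C}^d$, $$(1-|z|)^{-\beta-|x|}\prod_{i=1}^{d}\Big(1-\sum_{j=1}^{d}u_{i,j}z_j\Big)^{x_i}=\sum_{n\in\mathbb{N}_0^d}\frac{(\beta)_{|n|}}{n!}P_n(x;\mathfrak{m},\beta)\,z^n .$$ *)

theory Defs
  imports "HOL-Analysis.Analysis"
begin

text \<open>
  The dimension is \<open>d = CARD('n)\<close>. Coordinates \<open>1, \<dots>, d\<close> are indexed by \<open>'n\<close>, and the
  indices \<open>0, 1, \<dots>, d\<close> of the matrices by \<open>'n option\<close>, with \<open>None\<close> in the role of \<open>0\<close>.
  Multi-indices are functions \<open>'n \<Rightarrow> nat\<close>.
\<close>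

type_synonym 'n cmatrix = "((complex, 'n option) vec, 'n option) vec"

type_synonym 'n meixner_tuple = "complex \<times> 'n cmatrix \<times> 'n cmatrix \<times> 'n cmatrix"

definition mdeg :: "('n::finite \<Rightarrow> nat) \<Rightarrow> nat" where
  "mdeg n = (\<Sum>i\<in>UNIV. n i)"

definition mfact :: "('n::finite \<Rightarrow> nat) \<Rightarrow> complex" where
  "mfact n = (\<Prod>i\<in>UNIV. fact (n i))"

definition mpow :: "complex ^ 'n::finite \<Rightarrow> ('n \<Rightarrow> nat) \<Rightarrow> complex" where
  "mpow z n = (\<Prod>i\<in>UNIV. (z $ i) ^ n i)"

text \<open>The sum of the coordinates, without absolute values.\<close>

definition csum :: "complex ^ 'n::finite \<Rightarrow> complex" where
  "csum x = (\<Sum>i\<in>UNIV. x $ i)"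

definition of_multiindex :: "('n::finite \<Rightarrow> nat) \<Rightarrow> complex ^ 'n" where
  "of_multiindex n = (\<chi> i. of_nat (n i))"

text \<open>\<open>diag(1, -c\<^sub>1, \<dots>, -c\<^sub>d)\<close>\<close>

definition bordered_diag :: "complex ^ 'n::finite \<Rightarrow> 'n cmatrix" where
  "bordered_diag c =
     (\<chi> i j. if i = j then (case i of None \<Rightarrow> 1 | Some k \<Rightarrow> - (c $ k)) else 0)"

text \<open>The set \<open>M\<^sub>d\<close>; note that \<open>mat c\<^sub>0\<close> is \<open>c\<^sub>0\<close> times the identity matrix.\<close>

definition meixner_tuples :: "'n::finite meixner_tuple set" where
  "meixner_tuples = {(c\<^sub>0, C, C', U).
     c\<^sub>0 \<noteq> 0 \<and>
     (\<exists>c. C = bordered_diag c) \<and> (\<exists>c'. C' = bordered_diag c') \<and>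
     (\<forall>j. U $ None $ j = 1 \<and> U $ j $ None = 1) \<and>
     transpose U ** C ** U ** C' = mat c\<^sub>0}"

definition meixner_genfun ::
    "'n::finite meixner_tuple \<Rightarrow> complex \<Rightarrow> complex ^ 'n \<Rightarrow> complex ^ 'n \<Rightarrow> complex" where
  "meixner_genfun \<mm> \<beta> x z = (case \<mm> of (c\<^sub>0, C, C', U) \<Rightarrow>
     (1 - csum z) powr (- \<beta> - csum x) *
     (\<Prod>i\<in>UNIV. (1 - (\<Sum>j\<in>UNIV. U $ Some i $ Some j * z $ j)) powr (x $ i)))"

text \<open>
  \<open>meixner_poly \<mm> \<beta> n x\<close> is \<open>P\<^sub>n(x; \<mm>, \<beta>)\<close>. For each \<open>x\<close> the generating function is
  holomorphic near \<open>z = 0\<close>, and \<open>pochhammer \<beta> k \<noteq> 0\<close> for all \<open>k\<close> unless \<open>\<beta>\<close> is a nonpositive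
  integer, so the coefficient family \<open>p\<close> described here exists and is unique for such \<open>\<beta>\<close>.
\<close>

definition meixner_poly ::
    "'n::finite meixner_tuple \<Rightarrow> complex \<Rightarrow> ('n \<Rightarrow> nat) \<Rightarrow> complex ^ 'n \<Rightarrow> complex" where
  "meixner_poly \<mm> \<beta> n x =
     (THE p :: ('n \<Rightarrow> nat) \<Rightarrow> complex.
        \<forall>\<^sub>F z in nhds 0.
          ((\<lambda>k. pochhammer \<beta> (mdeg k) / mfact k * p k * mpow z k)
             has_sum meixner_genfun \<mm> \<beta> x z) UNIV) n"

end

theory Submission
  imports Defs
begin

text \<open>
  For small \<open>z\<close> and \<open>w\<close>, the generating functions at \<open>x\<close> in the variables \<open>z\<close> and \<open>w\<close> are
  multiplied, weighted by \<open>(\<beta>)\<^bsub>|x|\<^esub> c\<^sup>x / x!\<close>, and summed over \<open>x\<close> with the multivariate binomial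
  series. The result is a power \<open>-\<beta>\<close> of
  \<open>(1 - |z|) (1 - |w|) - \<Sum>\<^sub>i c\<^sub>i (1 - L\<^sub>i z) (1 - L\<^sub>i w)\<close> with \<open>L\<^sub>i z = \<Sum>\<^sub>j u\<^sub>i\<^sub>j z\<^sub>j\<close>, and the matrix
  identity turns this base into \<open>c\<^sub>0 (1 - \<Sum>\<^sub>j z\<^sub>j w\<^sub>j / c'\<^sub>j)\<close>. Only the monomials \<open>z\<^sup>n w\<^sup>n\<close> occur in
  its expansion, so comparing coefficients gives the orthogonality. The sum over \<open>x\<close> may be
  interchanged with the two expansions because the generating function at \<open>x\<close> has a power series
  whose absolute value on a small polydisc is at most a constant times \<open>Q\<close> to the power \<open>|x|\<close>,
  with \<open>Q\<close> arbitrarily close to \<open>1\<close>.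
\<close>

section \<open>Power series in several variables\<close>

lemma powser_zero_imp_coeff_zero:
  fixes h :: "nat \<Rightarrow> complex"
  assumes "r > 0" "\<And>t. norm t \<le> r \<Longrightarrow> (\<lambda>n. h n * t ^ n) sums 0"
  shows "h n = 0"
proof -
  have "fps_conv_radius (Abs_fps h) \<ge> r"
    unfolding fps_conv_radius_def using assms
    by (intro conv_radius_geI_ex') (auto simp: sums_iff)
  hence pos: "fps_conv_radius (Abs_fps h) > 0"
    using assms(1) by (meson ereal_less(2) less_le_trans)
  have "\<forall>\<^sub>F t in nhds 0. eval_fps (Abs_fps h) t = eval_fps 0 t"
    unfolding eventually_nhds_metric
    using assms by (auto intro!: exI[of _ r] simp: eval_fps_def sums_iff)
  from eval_fps_eqD[OF pos _ this] have "Abs_fps h = 0" by simp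
  thus ?thesis by (metis fps_nth_Abs_fps fps_zero_nth)
qed

text \<open>Induction on the set of active variables: freezing all but one of them leaves a
  one-variable series, whose coefficients are series in the remaining variables. Multi-indices stay
  functions on the whole type, with value 0 off \<open>S\<close>, so that the induction does not
  change the type.\<close>

lemma multi_powser_zero_imp_coeff_zero_on:
  fixes e :: "('n \<Rightarrow> nat) \<Rightarrow> complex"
  assumes "finite S" "r > 0"
    and "\<And>z :: 'n \<Rightarrow> complex. (\<And>i. norm (z i) \<le> r) \<Longrightarrow>
           ((\<lambda>k. e k * (\<Prod>i\<in>S. z i ^ k i)) has_sum 0) {k. \<forall>i. i \<notin> S \<longrightarrow> k i = 0}"
    and "\<forall>i. i \<notin> S \<longrightarrow> k i = 0"
  shows "e k = 0"
  using assms(1,3,4)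
proof (induction S arbitrary: e k rule: finite_induct)
  case empty
  have "{k :: 'n \<Rightarrow> nat. \<forall>i. k i = 0} = {\<lambda>_. 0}" by auto
  with empty(1)[of "\<lambda>_. 0"] \<open>r > 0\<close> have "e (\<lambda>_. 0) = 0"
    using has_sum_unique[OF has_sum_finiteI] by force
  moreover have "k = (\<lambda>_. 0)" using empty by auto
  ultimately show ?case by simp
next
  case (insert j S)
  let ?K = "\<lambda>S. {k :: 'n \<Rightarrow> nat. \<forall>i. i \<notin> S \<longrightarrow> k i = 0}"
  \<comment> \<open>The terms with exponent \<open>a\<close> at \<open>j\<close> form the
    coefficient of \<open>t ^ a\<close>; it vanishes because the series in \<open>t\<close> is zero
    near the origin.\<close>
  have zero: "((\<lambda>k. e (k(j := a)) * (\<Prod>i\<in>S. z i ^ k i)) has_sum 0) (?K S)"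
    if z: "\<And>i. norm (z i) \<le> r" for z :: "'n \<Rightarrow> complex" and a
  proof -
    define P where "P k = (\<Prod>i\<in>S. z i ^ k i)" for k
    have *: "((\<lambda>(a, k). e (k(j := a)) * t ^ a * P k) has_sum 0) (UNIV \<times> ?K S)"
      if "norm t \<le> r" for t
    proof -
      have "((\<lambda>k. e k * (\<Prod>i\<in>insert j S. (z(j := t)) i ^ k i)) has_sum 0) (?K (insert j S))"
        using z that by (intro insert.prems) auto
      also have "?this \<longleftrightarrow> ?thesis"
      proof (rule has_sum_reindex_bij_witness[of _ "\<lambda>(a,k). k(j := a)" "\<lambda>k. (k j, k(j := 0))"], goal_cases)
        case (5 k)
        have "(\<Prod>i\<in>S. (z(j := t)) i ^ k i) = P k" "P (k(j := 0)) = P k"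
          unfolding P_def using insert.hyps by (auto intro!: prod.cong)
        thus ?case using insert.hyps by simp
      qed (use insert.hyps in auto)
      finally show ?thesis .
    qed
    \<comment> \<open>Summability of each slice is read off at \<open>t = r\<close>, where the
      factor \<open>t ^ a\<close> is nonzero and can be cancelled.\<close>
    have "(\<lambda>(a, k). e (k(j := a)) * of_real r ^ a * P k) summable_on (UNIV \<times> ?K S)"
      using *[of "of_real r"] \<open>r > 0\<close> by (auto intro: has_sum_imp_summable)
    hence "(\<lambda>k. e (k(j := a)) * of_real r ^ a * P k) summable_on ?K S" for a
      by (rule summable_on_SigmaD1) auto
    hence "(\<lambda>k. of_real r ^ a * (e (k(j := a)) * P k)) summable_on ?K S" for a
      by (simp add: mult_ac)
    hence sm: "(\<lambda>k. e (k(j := a)) * P k) summable_on ?K S" for a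
      using \<open>r > 0\<close> by (subst (asm) summable_on_cmult_right') auto
    define h where "h a = infsum (\<lambda>k. e (k(j := a)) * P k) (?K S)" for a
    have "(\<lambda>a. h a * t ^ a) sums 0" if t: "norm t \<le> r" for t
    proof -
      have "((\<lambda>k. e (k(j := a)) * P k * t ^ a) has_sum (h a * t ^ a)) (?K S)" for a
        unfolding h_def using sm by (intro has_sum_cmult_left has_sum_infsum)
      hence "((\<lambda>a. h a * t ^ a) has_sum 0) UNIV"
        by (intro has_sum_SigmaD[OF *[OF t]]) (simp add: mult_ac)
      thus ?thesis by (rule has_sum_imp_sums)
    qed
    hence "h a = 0" using powser_zero_imp_coeff_zero \<open>r > 0\<close> by blast
    thus ?thesis using has_sum_infsum[OF sm, of a] by (simp add: h_def P_def)
  qed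
  have "e ((k(j := 0))(j := k j)) = 0"
    by (rule insert.IH[where e = "\<lambda>l. e (l(j := k j))"]) (use zero insert.prems in auto)
  thus ?case by simp
qed

lemma multi_powser_eq_imp_coeff_eq:
  fixes a b :: "('n::finite \<Rightarrow> nat) \<Rightarrow> complex"
  assumes "r > 0"
    and "\<And>z. (\<And>i. norm (z $ i) \<le> r) \<Longrightarrow> ((\<lambda>k. a k * mpow z k) has_sum f z) UNIV"
    and "\<And>z. (\<And>i. norm (z $ i) \<le> r) \<Longrightarrow> ((\<lambda>k. b k * mpow z k) has_sum f z) UNIV"
  shows "a = b"
proof
  fix k
  have "a k - b k = 0"
  proof (rule multi_powser_zero_imp_coeff_zero_on[where S = UNIV and e = "\<lambda>k. a k - b k"])
    fix z :: "'n \<Rightarrow> complex" assume "\<And>i. norm (z i) \<le> r"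
    with has_sum_add[OF assms(2)[of "vec_lambda z"] has_sum_uminusI[OF assms(3)[of "vec_lambda z"]]]
    show "((\<lambda>k. (a k - b k) * (\<Prod>i\<in>UNIV. z i ^ k i)) has_sum 0) {k. \<forall>i. i \<notin> UNIV \<longrightarrow> k i = 0}"
      by (simp add: mpow_def algebra_simps)
  qed (use assms in auto)
  thus "a k = b k" by simp
qed

section \<open>Multinomial theorem and grouping of sums by fibres\<close>

text \<open>This is the multinomial theorem divided by \<open>fact N\<close>. In this normalisation
  the summand is a product over coordinates, so adding one index to \<open>S\<close> amounts to the
  binomial theorem.\<close>

lemma sum_exp_terms_fixed_degree:
  fixes z :: "'n \<Rightarrow> 'a::field_char_0"
  assumes "finite S"
  shows "finite {k :: 'n \<Rightarrow> nat. (\<forall>i. i \<notin> S \<longrightarrow> k i = 0) \<and> sum k S = N} \<and>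
    (\<Sum>k | (\<forall>i. i \<notin> S \<longrightarrow> k i = 0) \<and> sum k S = N. \<Prod>i\<in>S. z i ^ k i / fact (k i))
           = (\<Sum>i\<in>S. z i) ^ N / fact N"
proof -
  let ?K = "\<lambda>S N. {k :: 'n \<Rightarrow> nat. (\<forall>i. i \<notin> S \<longrightarrow> k i = 0) \<and> sum k S = N}"
  have "finite (?K S N) \<and> (\<Sum>k\<in>?K S N. \<Prod>i\<in>S. z i ^ k i / fact (k i))
           = (\<Sum>i\<in>S. z i) ^ N / fact N"
    using assms
  proof (induction S arbitrary: N rule: finite_induct)
    case empty
    have "?K {} N = (if N = 0 then {\<lambda>_. 0} else {})" by auto
    thus ?case by (cases "N = 0") auto
  next
    case (insert j S)
    \<comment> \<open>A multi-index on \<open>insert j S\<close> is split into its exponent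
      \<open>a\<close> at \<open>j\<close> and the multi-index reset to 0 at \<open>j\<close>, of
      degree \<open>N - a\<close>.\<close>
    have eq: "?K (insert j S) N = (\<lambda>(a,k). k(j := a)) ` (SIGMA a:{..N}. ?K S (N - a))" 
    proof (intro equalityI subsetI)
      fix k assume k: "k \<in> ?K (insert j S) N"
      have "sum (k(j := 0)) S = sum k S" using insert.hyps by (intro sum.cong) auto
      hence "(k j, k(j := 0)) \<in> (SIGMA a:{..N}. ?K S (N - a))"
        using k insert.hyps by auto
      thus "k \<in> (\<lambda>(a,k). k(j := a)) ` (SIGMA a:{..N}. ?K S (N - a))"
        by (rule rev_image_eqI) simp
    next
      fix k assume "k \<in> (\<lambda>(a,k). k(j := a)) ` (SIGMA a:{..N}. ?K S (N - a))"
      then obtain a l where al: "a \<le> N" "l \<in> ?K S (N - a)" "k = l(j := a)" by auto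
      have "sum (l(j := a)) S = sum l S" using insert.hyps by (intro sum.cong) auto
      thus "k \<in> ?K (insert j S) N" using al insert.hyps by simp
    qed
    have inj: "inj_on (\<lambda>(a,k). k(j := a)) (SIGMA a:{..N}. ?K S (N - a))"
    proof (rule inj_on_inverseI[of _ "\<lambda>k. (k j, k(j := 0))"])
      fix p assume "p \<in> (SIGMA a:{..N}. ?K S (N - a))"
      thus "(\<lambda>k. (k j, k(j := 0))) ((\<lambda>(a,k). k(j := a)) p) = p"
        using insert.hyps by (auto simp: fun_eq_iff)
    qed
    have "(\<Sum>k\<in>?K (insert j S) N. \<Prod>i\<in>insert j S. z i ^ k i / fact (k i))
        = (\<Sum>(a,k)\<in>(SIGMA a:{..N}. ?K S (N - a)). (z j ^ a / fact a) * (\<Prod>i\<in>S. z i ^ k i / fact (k i)))"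
      unfolding eq sum.reindex[OF inj]
    proof (rule sum.cong[OF refl])
      fix p :: "nat \<times> ('n \<Rightarrow> nat)"
      obtain a k where p: "p = (a, k)" by fastforce
      have "(\<Prod>i\<in>S. z i ^ (k(j := a)) i / fact ((k(j := a)) i)) = (\<Prod>i\<in>S. z i ^ k i / fact (k i))"
        using insert.hyps by (intro prod.cong) auto
      thus "((\<lambda>k. \<Prod>i\<in>insert j S. z i ^ k i / fact (k i)) \<circ> (\<lambda>(a, k). k(j := a))) p
          = (case p of (a, k) \<Rightarrow> z j ^ a / fact a * (\<Prod>i\<in>S. z i ^ k i / fact (k i)))"
        using insert.hyps by (simp add: p)
    qed
    also have "\<dots> = (\<Sum>a\<le>N. (z j ^ a / fact a) * ((\<Sum>i\<in>S. z i) ^ (N - a) / fact (N - a)))"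
      using insert.IH
      by (subst sum.Sigma[symmetric])
         (auto simp: sum_distrib_left[symmetric] simp del: times_divide_eq_left intro!: sum.cong)
    also have "\<dots> = (z j + (\<Sum>i\<in>S. z i)) ^ N / fact N"
      unfolding binomial_ring sum_divide_distrib
      by (intro sum.cong) (auto simp: binomial_fact field_simps)
    finally show ?case using insert eq by simp
  qed
  thus ?thesis by simp
qed

text \<open>The index type is the disjoint union of the fibres of \<open>s\<close>. The map
  \<open>s\<close> will be the degree, or the addition of two exponents in a Cauchy product.\<close>

lemma has_sum_fibers:
  fixes f :: "'a \<Rightarrow> 'c::banach"
  assumes "(f has_sum S) UNIV"
  shows "((\<lambda>k. infsum f {p. s p = k}) has_sum S) UNIV"
proof (rule has_sum_SigmaD)
  show "((\<lambda>(k, p). f p) has_sum S) (SIGMA k:UNIV. {p. s p = k})"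
    using assms
    by (subst has_sum_reindex_bij_witness[of _ "\<lambda>p. (s p, p)" snd UNIV f]) auto
  have "f summable_on {p. s p = k}" for k
    using assms by (meson has_sum_imp_summable subset_UNIV summable_on_subset_banach)
  thus "((\<lambda>p. case (k, p) of (k, p) \<Rightarrow> f p) has_sum infsum f {p. s p = k}) {p. s p = k}" for k
    by simp
qed

text \<open>A converse to grouping: without cancellation, summability of the fibre sums forces
  summability of the whole family.\<close>

lemma summable_on_fibers_nonneg:
  fixes f :: "'a \<Rightarrow> real"
  assumes "\<And>p. f p \<ge> 0" "\<And>k. (f has_sum g k) {p. s p = k}" "g summable_on UNIV"
  shows "f summable_on UNIV"
proof -
  have "(\<lambda>(k, p). f p) summable_on (SIGMA k:UNIV. {p. s p = k})"
    using assms by (intro summable_on_SigmaI[where g = g]) auto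
  thus ?thesis
    by (subst summable_on_reindex_bij_witness[of _ snd "\<lambda>p. (s p, p)"  "SIGMA k:UNIV. {p. s p = k}" "\<lambda>(k, p). f p"]) auto
qed

lemma has_sum_multi_exp_terms:
  fixes z :: "'n::finite \<Rightarrow> 'a::{real_normed_field}"
  shows "((\<lambda>k. f (mdeg k) * (\<Prod>i\<in>UNIV. z i ^ k i / fact (k i))) has_sum
           (f N / fact N * (\<Sum>i\<in>UNIV. z i) ^ N)) {k. mdeg k = N}"
proof (rule has_sum_finiteI)
  note * = sum_exp_terms_fixed_degree[of "UNIV :: 'n set" N z]
  show "finite {k :: 'n \<Rightarrow> nat. mdeg k = N}" using * by (simp add: mdeg_def)
  have "(\<Sum>k | mdeg k = N. f (mdeg k) * (\<Prod>i\<in>UNIV. z i ^ k i / fact (k i)))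
      = f N * (\<Sum>k | mdeg k = N. (\<Prod>i\<in>UNIV. z i ^ k i / fact (k i)))"
    by (simp add: sum_distrib_left)
  also have "\<dots> = f N / fact N * (\<Sum>i\<in>UNIV. z i) ^ N"
    using * by (simp add: mdeg_def)
  finally show "f N / fact N * (\<Sum>i\<in>UNIV. z i) ^ N =
     (\<Sum>k | mdeg k = N. f (mdeg k) * (\<Prod>i\<in>UNIV. z i ^ k i / fact (k i)))" ..
qed

section \<open>The multivariate binomial series\<close>

lemma pochhammer_power_series_sums:
  fixes s z :: complex
  assumes "norm z < 1"
  shows "(\<lambda>N. pochhammer s N / fact N * z ^ N) sums ((1 - z) powr (- s))"
proof -
  have "(\<lambda>n. (- s gchoose n) * (- z) ^ n) sums (1 + (- z)) powr (- s)"
    using assms by (intro gen_binomial_complex) auto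
  moreover have "(- s gchoose n) * (- z) ^ n = pochhammer s n / fact n * z ^ n" for n
    by (simp add: gbinomial_pochhammer power_mult_distrib[symmetric] mult_ac)
  ultimately show ?thesis by simp
qed

lemma pochhammer_nonneg':
  fixes t :: "'a::linordered_semidom"
  assumes "t \<ge> 0"
  shows "pochhammer t N \<ge> 0"
  unfolding pochhammer_prod using assms by (intro prod_nonneg) auto

lemma norm_pochhammer_le:
  fixes s :: "'a::real_normed_field"
  assumes "norm s \<le> t"
  shows "norm (pochhammer s N) \<le> pochhammer t N"
  unfolding pochhammer_prod prod_norm[symmetric]
proof (intro prod_mono conjI)
  fix i
  show "norm (s + of_nat i) \<le> t + of_nat i"
    using norm_triangle_ineq[of s "of_nat i"] assms by simp
qed auto

lemma pochhammer_power_series_sums_real: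
  fixes t \<rho> :: real
  assumes "0 \<le> \<rho>" "\<rho> < 1"
  shows "(\<lambda>N. pochhammer t N / fact N * \<rho> ^ N) sums ((1 - \<rho>) powr (- t))"
proof -
  have "(\<lambda>N. of_real (pochhammer t N / fact N * \<rho> ^ N) :: complex) sums
          ((1 - of_real \<rho>) powr (- of_real t))"
    using pochhammer_power_series_sums[of "of_real \<rho>" "of_real t"] assms
    by (simp add: pochhammer_of_real)
  also have "(1 - of_real \<rho> :: complex) powr (- of_real t) = of_real ((1 - \<rho>) powr (- t))"
    using powr_of_real[of "1 - \<rho>" "- t"] assms by simp
  finally show ?thesis by (subst (asm) sums_of_real_iff)
qed

text \<open>Grouping by degree turns the series into the one-variable binomial series in the sum of
  the variables. Nonnegative terms make summability follow from that of the grouped series.\<close>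

lemma multi_pochhammer_has_sum_real:
  fixes \<rho> :: "'n::finite \<Rightarrow> real" and t :: real
  assumes "\<And>i. \<rho> i \<ge> 0" "(\<Sum>i\<in>UNIV. \<rho> i) < 1" "t \<ge> 0"
  shows "((\<lambda>k. pochhammer t (mdeg k) * (\<Prod>i\<in>UNIV. \<rho> i ^ k i / fact (k i))) has_sum
           ((1 - (\<Sum>i\<in>UNIV. \<rho> i)) powr (- t))) UNIV"
proof -
  let ?f = "\<lambda>k. pochhammer t (mdeg k) * (\<Prod>i\<in>UNIV. \<rho> i ^ k i / fact (k i))"
  define R where "R = (\<Sum>i\<in>UNIV. \<rho> i)"
  have R: "0 \<le> R" "R < 1" using assms by (auto simp: R_def sum_nonneg)
  have poch: "pochhammer t N \<ge> 0" for N using assms(3) by (rule pochhammer_nonneg')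
  have g: "((\<lambda>N. pochhammer t N / fact N * R ^ N) has_sum ((1 - R) powr (- t))) UNIV"
    using pochhammer_power_series_sums_real[OF R, of t] R poch
    by (intro sums_nonneg_imp_has_sum) auto
  have fib: "(?f has_sum (pochhammer t N / fact N * R ^ N)) {k. mdeg k = N}" for N
    unfolding R_def by (rule has_sum_multi_exp_terms)
  have "?f summable_on UNIV"
    using assms poch
    by (intro summable_on_fibers_nonneg[OF _ fib has_sum_imp_summable[OF g]])
       (auto intro!: mult_nonneg_nonneg prod_nonneg)
  hence "(?f has_sum infsum ?f UNIV) UNIV" by simp
  from has_sum_fibers[OF this, of mdeg] have "((\<lambda>N. pochhammer t N / fact N * R ^ N) has_sum infsum ?f UNIV) UNIV"
    using infsumI[OF fib] by simp
  with g have "infsum ?f UNIV = (1 - R) powr (- t)" using has_sum_unique by blast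
  with \<open>(?f has_sum infsum ?f UNIV) UNIV\<close> show ?thesis by (simp add: R_def)
qed

text \<open>The real series with parameter \<open>norm s\<close> and variables
  \<open>norm (z i)\<close> dominates termwise. This supplies the summability needed to regroup the
  complex series by degree.\<close>

lemma multi_pochhammer_abs_summable:
  fixes z :: "'n::finite \<Rightarrow> complex" and s :: complex
  assumes "(\<Sum>i\<in>UNIV. norm (z i)) < 1"
  shows "(\<lambda>k. norm (pochhammer s (mdeg k) * (\<Prod>i\<in>UNIV. z i ^ k i / fact (k i)))) summable_on UNIV"
proof (rule Infinite_Sum.abs_summable_on_comparison_test')
  show "(\<lambda>k. pochhammer (norm s) (mdeg k) * (\<Prod>i\<in>UNIV. norm (z i) ^ k i / fact (k i))) summable_on UNIV"
    using assms by (intro has_sum_imp_summable[OF multi_pochhammer_has_sum_real]) auto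
qed (auto simp: norm_mult prod_norm[symmetric] norm_divide norm_power
          intro!: mult_mono norm_pochhammer_le prod_nonneg pochhammer_nonneg')

lemma multi_pochhammer_has_sum:
  fixes z :: "'n::finite \<Rightarrow> complex" and s :: complex
  assumes "(\<Sum>i\<in>UNIV. norm (z i)) < 1"
  shows "((\<lambda>k. pochhammer s (mdeg k) * (\<Prod>i\<in>UNIV. z i ^ k i / fact (k i))) has_sum
           ((1 - (\<Sum>i\<in>UNIV. z i)) powr (- s))) UNIV"
proof -
  let ?f = "\<lambda>k. pochhammer s (mdeg k) * (\<Prod>i\<in>UNIV. z i ^ k i / fact (k i))"
  define Z where "Z = (\<Sum>i\<in>UNIV. z i)"
  have Z: "norm Z < 1" using assms norm_sum[of z UNIV] by (simp add: Z_def)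
  have f: "(?f has_sum infsum ?f UNIV) UNIV"
    by (rule has_sum_infsum[OF Infinite_Sum.abs_summable_summable[OF multi_pochhammer_abs_summable[OF assms]]])
  have fib: "(?f has_sum (pochhammer s N / fact N * Z ^ N)) {k. mdeg k = N}" for N
    unfolding Z_def by (rule has_sum_multi_exp_terms)
  from has_sum_fibers[OF f, of mdeg] have "((\<lambda>N. pochhammer s N / fact N * Z ^ N) has_sum infsum ?f UNIV) UNIV"
    using infsumI[OF fib] by simp
  hence "(\<lambda>N. pochhammer s N / fact N * Z ^ N) sums infsum ?f UNIV"
    by (rule has_sum_imp_sums)
  hence "infsum ?f UNIV = (1 - Z) powr (- s)"
    using pochhammer_power_series_sums[OF Z] sums_unique2 by blast
  with f show ?thesis by (simp add: Z_def)
qed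

lemma mpow_div_mfact: "mpow z k / mfact k = (\<Prod>i\<in>UNIV. (z $ i) ^ k i / fact (k i))"
  by (simp add: mpow_def mfact_def prod_dividef)

section \<open>Norm bounds for power series on a polydisc\<close>

text \<open>\<open>B\<close> bounds the value at \<open>(r, \<dots>, r)\<close> of the coefficientwise absolute value of the power
  series of \<open>f\<close>; such bounds are submultiplicative.\<close>

definition has_powser_bound :: "real \<Rightarrow> real \<Rightarrow> (complex ^ 'n::finite \<Rightarrow> complex) \<Rightarrow> bool" where
  "has_powser_bound r B f \<longleftrightarrow> (\<exists>a A. A \<le> B \<and> ((\<lambda>k. norm (a k) * r ^ mdeg k) has_sum A) UNIV \<and>
     (\<forall>z. (\<forall>i. norm (z $ i) \<le> r) \<longrightarrow> ((\<lambda>k. a k * mpow z k) has_sum f z) UNIV))"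

lemma has_powser_boundI:
  assumes "((\<lambda>k. norm (a k) * r ^ mdeg k) has_sum A) UNIV" "A \<le> B"
    and "\<And>z. \<forall>i. norm (z $ i) \<le> r \<Longrightarrow> ((\<lambda>k. a k * mpow z k) has_sum f z) UNIV"
  shows "has_powser_bound r B f"
  unfolding has_powser_bound_def using assms by (intro exI[of _ a] exI[of _ A]) auto

lemma has_powser_boundE:
  assumes "has_powser_bound r B f"
  obtains a A where "A \<le> B" "((\<lambda>k. norm (a k) * r ^ mdeg k) has_sum A) UNIV"
    "\<And>z. \<forall>i. norm (z $ i) \<le> r \<Longrightarrow> ((\<lambda>k. a k * mpow z k) has_sum f z) UNIV"
  using assms unfolding has_powser_bound_def by (elim exE conjE) auto

lemma norm_mpow_le:
  assumes "\<forall>i. norm (z $ i) \<le> r"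
  shows "norm (mpow z k) \<le> r ^ mdeg k"
  unfolding mpow_def mdeg_def power_sum prod_norm[symmetric] norm_power
  using assms by (intro prod_mono) (auto intro: power_mono)

lemma has_powser_bound_mono: "has_powser_bound r A f \<Longrightarrow> A \<le> B \<Longrightarrow> has_powser_bound r B f"
  unfolding has_powser_bound_def by (meson order.trans)

lemma has_powser_bound_const: "has_powser_bound r (norm c) (\<lambda>_. c)"
proof -
  let ?a = "\<lambda>k. if k = (\<lambda>_. 0) then c else 0"
  have "((\<lambda>k. norm (?a k) * r ^ mdeg k) has_sum norm c) UNIV"
    by (rule has_sum_finite_neutralI[of "{\<lambda>_. 0}"]) (auto simp: mdeg_def)
  moreover have "((\<lambda>k. ?a k * mpow z k) has_sum c) UNIV" for z
    by (rule has_sum_finite_neutralI[of "{\<lambda>_. 0}"]) (auto simp: mpow_def)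
  ultimately show ?thesis by (intro has_powser_boundI[of ?a]) auto
qed

lemma has_powser_bound_coord: "has_powser_bound r r (\<lambda>z. z $ j)"
proof -
  let ?e = "\<lambda>i. if i = j then 1 else 0 :: nat"
  let ?a = "\<lambda>k. if k = ?e then 1 else 0 :: complex"
  have "((\<lambda>k. norm (?a k) * r ^ mdeg k) has_sum r) UNIV"
    by (rule has_sum_finite_neutralI[of "{?e}"]) (auto simp: mdeg_def)
  moreover have "mpow z ?e = z $ j" for z :: "complex ^ 'a"
    by (simp add: mpow_def if_distrib[of "\<lambda>k. _ ^ k"] cong: if_cong)
  hence "((\<lambda>k. ?a k * mpow z k) has_sum (z $ j)) UNIV" for z
    by (intro has_sum_finite_neutralI[of "{?e}"]) auto
  ultimately show ?thesis by (intro has_powser_boundI[of ?a]) auto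
qed

lemma has_powser_bound_add:
  fixes f g :: "complex ^ 'n::finite \<Rightarrow> complex"
  assumes "has_powser_bound r A f" "has_powser_bound r B g" "r \<ge> 0"
  shows "has_powser_bound r (A + B) (\<lambda>z. f z + g z)"
proof -
  from assms(1,2) obtain a A' b B' where
    a: "A' \<le> A" "((\<lambda>k. norm (a k) * r ^ mdeg k) has_sum A') UNIV"
       "\<And>z. (\<forall>i. norm (z $ i) \<le> r) \<Longrightarrow> ((\<lambda>k. a k * mpow z k) has_sum f z) UNIV"
    and b: "B' \<le> B" "((\<lambda>k. norm (b k) * r ^ mdeg k) has_sum B') UNIV"
       "\<And>z. (\<forall>i. norm (z $ i) \<le> r) \<Longrightarrow> ((\<lambda>k. b k * mpow z k) has_sum g z) UNIV"
    by (elim has_powser_boundE) blast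
  let ?c = "\<lambda>k. norm (a k + b k) * r ^ mdeg k"
  have *: "((\<lambda>k. norm (a k) * r ^ mdeg k + norm (b k) * r ^ mdeg k) has_sum (A' + B')) UNIV"
    by (intro has_sum_add a b)
  have le: "?c k \<le> norm (a k) * r ^ mdeg k + norm (b k) * r ^ mdeg k" for k
    using norm_triangle_ineq[of "a k" "b k"] \<open>r \<ge> 0\<close>
    by (simp add: mult_right_mono flip: distrib_right)
  have "?c summable_on UNIV"
    using le \<open>r \<ge> 0\<close> by (intro summable_on_comparison_test[OF has_sum_imp_summable[OF *]]) auto
  then obtain C where C: "(?c has_sum C) UNIV" unfolding summable_on_def by blast
  have "C \<le> A' + B'" using le by (intro has_sum_mono[OF C *])
  moreover have "((\<lambda>k. (a k + b k) * mpow z k) has_sum (f z + g z)) UNIV" if "\<forall>i. norm (z $ i) \<le> r" for z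
    using has_sum_add[OF a(3)[OF that] b(3)[OF that]] by (simp add: distrib_right)
  ultimately show ?thesis
    using C a(1) b(1) by (intro has_powser_boundI[of "\<lambda>k. a k + b k" r C]) auto
qed

lemma mdeg_add: "mdeg (\<lambda>i. k i + l i) = mdeg k + mdeg l"
  by (simp add: mdeg_def sum.distrib)

lemma mpow_add: "mpow z (\<lambda>i. k i + l i) = mpow z k * mpow z l"
  by (simp add: mpow_def power_add prod.distrib)

text \<open>Summability of a complex family is absolute, so the product family is summable over the
  rectangle and may be summed row by row.\<close>

lemma has_sum_mult_complex:
  fixes f :: "'a \<Rightarrow> complex" and g :: "'b \<Rightarrow> complex"
  assumes "(f has_sum S) A" "(g has_sum T) B"
  shows "((\<lambda>(x, y). f x * g y) has_sum (S * T)) (A \<times> B)"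
proof (rule has_sum_SigmaI)
  have fg: "(\<lambda>x. norm (f x)) summable_on A" "(\<lambda>y. norm (g y)) summable_on B"
    using assms by (auto simp flip: summable_on_iff_abs_summable_on_complex dest: has_sum_imp_summable)
  have "(\<lambda>(x, y). norm (f x) * norm (g y)) summable_on A \<times> B"
  proof (rule summable_on_SigmaI)
    show "((\<lambda>y. case (x, y) of (x, y) \<Rightarrow> norm (f x) * norm (g y)) has_sum
            (norm (f x) * infsum (\<lambda>y. norm (g y)) B)) B" for x
      using has_sum_cmult_right[OF has_sum_infsum[OF fg(2)]] by simp
  qed (use fg(1) in \<open>auto intro: summable_on_cmult_left\<close>)
  hence "(\<lambda>p. norm (case p of (x, y) \<Rightarrow> f x * g y)) summable_on A \<times> B"
    by (simp add: norm_mult case_prod_unfold)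
  thus "(\<lambda>(x, y). f x * g y) summable_on A \<times> B"
    by (rule Infinite_Sum.abs_summable_summable)
next
  show "((\<lambda>x. f x * T) has_sum S * T) A" using assms(1) by (rule has_sum_cmult_left)
next
  fix x
  show "((\<lambda>y. case (x, y) of (x, y) \<Rightarrow> f x * g y) has_sum f x * T) B"
    using has_sum_cmult_right[OF assms(2)] by simp
qed

text \<open>The Cauchy product: the double series is grouped by the sum of the exponents, and the
  triangle inequality on each fibre bounds the new coefficients by those of the product of the two
  majorants.\<close>

lemma has_powser_bound_mult:
  fixes f g :: "complex ^ 'n::finite \<Rightarrow> complex"
  assumes "has_powser_bound r A f" "has_powser_bound r B g" "r > 0"
  shows "has_powser_bound r (A * B) (\<lambda>z. f z * g z)"
proof -
  from assms(1,2) obtain a A' b B' where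
    a: "A' \<le> A" "((\<lambda>k. norm (a k) * r ^ mdeg k) has_sum A') UNIV"
       "\<And>z. (\<forall>i. norm (z $ i) \<le> r) \<Longrightarrow> ((\<lambda>k. a k * mpow z k) has_sum f z) UNIV"
    and b: "B' \<le> B" "((\<lambda>k. norm (b k) * r ^ mdeg k) has_sum B') UNIV"
       "\<And>z. (\<forall>i. norm (z $ i) \<le> r) \<Longrightarrow> ((\<lambda>k. b k * mpow z k) has_sum g z) UNIV"
    by (elim has_powser_boundE) blast
  have AB: "0 \<le> A'" "0 \<le> B'" using a b \<open>r > 0\<close> by (auto intro: has_sum_nonneg)
  define s :: "('n \<Rightarrow> nat) \<times> ('n \<Rightarrow> nat) \<Rightarrow> 'n \<Rightarrow> nat" where "s = (\<lambda>(k, l) i. k i + l i)"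
  define P where "P = (\<lambda>(k, l). a k * b l)"
  define c where "c k = infsum P {p. s p = k}" for k
  \<comment> \<open>The real product is computed inside the complex numbers, where
    \<open>has_sum_mult_complex\<close> applies, and then pulled back.\<close>
  have N: "((\<lambda>p. norm (P p) * r ^ mdeg (s p)) has_sum A' * B') UNIV"
  proof -
    have "((\<lambda>(k, l). complex_of_real (norm (a k) * r ^ mdeg k) * of_real (norm (b l) * r ^ mdeg l))
              has_sum (of_real A' * of_real B')) (UNIV \<times> UNIV)"
      using a(2) b(2) by (intro has_sum_mult_complex has_sum_of_real)
    hence "((\<lambda>p. complex_of_real (norm (P p) * r ^ mdeg (s p))) has_sum of_real (A' * B')) UNIV"
      by (simp add: P_def s_def norm_mult mdeg_add power_add case_prod_unfold mult_ac)
    thus ?thesis by (subst (asm) has_sum_of_real_iff)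
  qed
  \<comment> \<open>On a fibre the weight is the constant \<open>r ^ mdeg k\<close>, which is
    nonzero and can be cancelled.\<close>
  have abs: "(\<lambda>p. norm (P p)) summable_on {p. s p = k}" for k
  proof -
    have "(\<lambda>p. norm (P p) * r ^ mdeg (s p)) summable_on {p. s p = k}"
      using N by (meson has_sum_imp_summable subset_UNIV summable_on_subset_banach)
    also have "?this \<longleftrightarrow> (\<lambda>p. norm (P p) * r ^ mdeg k) summable_on {p. s p = k}"
      by (intro summable_on_cong) auto
    finally show ?thesis using \<open>r > 0\<close> by (subst (asm) summable_on_cmult_left') auto
  qed
  have Nf: "((\<lambda>k. infsum (\<lambda>p. norm (P p)) {p. s p = k} * r ^ mdeg k) has_sum A' * B') UNIV"
  proof -
    have "infsum (\<lambda>p. norm (P p) * r ^ mdeg (s p)) {p. s p = k}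
        = infsum (\<lambda>p. norm (P p)) {p. s p = k} * r ^ mdeg k" for k
      unfolding infsum_cmult_left'[symmetric] by (intro infsum_cong) auto
    thus ?thesis using has_sum_fibers[OF N, of s] by simp
  qed
  have le: "norm (c k) * r ^ mdeg k \<le> infsum (\<lambda>p. norm (P p)) {p. s p = k} * r ^ mdeg k" for k
    unfolding c_def using \<open>r > 0\<close> by (intro mult_right_mono norm_infsum_bound abs) auto
  have "(\<lambda>k. norm (c k) * r ^ mdeg k) summable_on UNIV"
    using le \<open>r > 0\<close> by (intro summable_on_comparison_test[OF has_sum_imp_summable[OF Nf]]) auto
  then obtain C where C: "((\<lambda>k. norm (c k) * r ^ mdeg k) has_sum C) UNIV"
    unfolding summable_on_def by blast
  have "C \<le> A' * B'" using le by (intro has_sum_mono[OF C Nf])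
  also have "\<dots> \<le> A * B" using a(1) b(1) AB by (intro mult_mono) auto
  finally have "C \<le> A * B" .
  moreover have "((\<lambda>k. c k * mpow z k) has_sum (f z * g z)) UNIV" if z: "\<forall>i. norm (z $ i) \<le> r" for z
  proof -
    have "((\<lambda>(k, l). (a k * mpow z k) * (b l * mpow z l)) has_sum (f z * g z)) (UNIV \<times> UNIV)"
      using a(3)[OF z] b(3)[OF z] by (intro has_sum_mult_complex)
    hence *: "((\<lambda>p. P p * mpow z (s p)) has_sum (f z * g z)) UNIV"
      by (simp add: P_def s_def mpow_add case_prod_unfold mult_ac)
    have "infsum (\<lambda>p. P p * mpow z (s p)) {p. s p = k} = c k * mpow z k" for k
      unfolding infsum_cmult_left'[symmetric] c_def by (intro infsum_cong) auto
    thus ?thesis using has_sum_fibers[OF *, of s] by simp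
  qed
  ultimately show ?thesis
    using C by (intro has_powser_boundI[of c])
qed

lemma has_powser_bound_sum:
  assumes "finite S" "\<And>i. i \<in> S \<Longrightarrow> has_powser_bound r (A i) (f i)" "r \<ge> 0"
  shows "has_powser_bound r (\<Sum>i\<in>S. A i) (\<lambda>z. \<Sum>i\<in>S. f i z)"
  using assms(1,2)
proof (induction S rule: finite_induct)
  case empty
  show ?case using has_powser_bound_const[of r 0] by simp
next
  case (insert i S)
  have "has_powser_bound r (A i) (f i)" using insert.prems by simp
  from has_powser_bound_add[OF this insert.IH assms(3)] show ?case
    using insert by simp
qed

lemma has_powser_bound_prod:
  assumes "finite S" "\<And>i. i \<in> S \<Longrightarrow> has_powser_bound r (A i) (f i)" "r > 0"
  shows "has_powser_bound r (\<Prod>i\<in>S. A i) (\<lambda>z. \<Prod>i\<in>S. f i z)"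
  using assms(1,2)
proof (induction S rule: finite_induct)
  case empty
  show ?case using has_powser_bound_const[of r 1] by simp
next
  case (insert i S)
  have "has_powser_bound r (A i) (f i)" using insert.prems by simp
  from has_powser_bound_mult[OF this insert.IH assms(3)] show ?case
    using insert by simp
qed

lemma has_powser_bound_power:
  assumes "has_powser_bound r A f" "r > 0"
  shows "has_powser_bound r (A ^ n) (\<lambda>z. f z ^ n)"
  using has_powser_bound_prod[of "{..<n}" r "\<lambda>_. A" "\<lambda>_. f"] assms by simp

lemma has_powser_bound_one_minus_linear:
  fixes u :: "'n::finite \<Rightarrow> complex"
  assumes "r > 0"
  shows "has_powser_bound r (1 + (\<Sum>j\<in>UNIV. norm (u j)) * r) (\<lambda>z. 1 - (\<Sum>j\<in>UNIV. u j * z $ j))"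
proof -
  have "has_powser_bound r (norm (1 :: complex) + (\<Sum>j\<in>UNIV. norm (- u j) * r))
          (\<lambda>z. 1 + (\<Sum>j\<in>UNIV. - u j * z $ j))"
    using assms by (intro has_powser_bound_add has_powser_bound_const has_powser_bound_sum
        has_powser_bound_mult has_powser_bound_coord) auto
  thus ?thesis by (simp add: sum_distrib_right sum_negf)
qed

text \<open>Replacing \<open>s\<close> by \<open>norm s\<close> and every variable by
  \<open>r\<close> gives a binomial series with nonnegative terms that dominates the absolute
  values.\<close>

lemma has_powser_bound_one_minus_csum_powr:
  fixes s :: complex
  assumes "r \<ge> 0" "real CARD('n) * r < 1"
  shows "has_powser_bound r ((1 - real CARD('n) * r) powr (- norm s))
           (\<lambda>z :: complex ^ 'n::finite. (1 - csum z) powr (- s))"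
proof -
  define a where "a k = pochhammer s (mdeg k) / mfact k" for k :: "'n \<Rightarrow> nat"
  have R: "((\<lambda>k. pochhammer (norm s) (mdeg k) * (\<Prod>i\<in>UNIV. r ^ k i / fact (k i))) has_sum
           ((1 - real CARD('n) * r) powr (- norm s))) (UNIV :: ('n \<Rightarrow> nat) set)"
    using assms multi_pochhammer_has_sum_real[of "\<lambda>_ :: 'n. r" "norm s"] by simp
  have le: "norm (a k) * r ^ mdeg k \<le> pochhammer (norm s) (mdeg k) * (\<Prod>i\<in>UNIV. r ^ k i / fact (k i))" for k
  proof -
    have "norm (a k) * r ^ mdeg k = norm (pochhammer s (mdeg k)) * (\<Prod>i\<in>UNIV. r ^ k i / fact (k i))"
      by (simp add: a_def norm_divide mfact_def prod_norm[symmetric] mdeg_def power_sum prod_dividef)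
    also have "\<dots> \<le> pochhammer (norm s) (mdeg k) * (\<Prod>i\<in>UNIV. r ^ k i / fact (k i))"
      using assms by (intro mult_right_mono norm_pochhammer_le prod_nonneg) auto
    finally show ?thesis .
  qed
  have "(\<lambda>k. norm (a k) * r ^ mdeg k) summable_on UNIV"
    using le assms by (intro summable_on_comparison_test[OF has_sum_imp_summable[OF R]]) auto
  then obtain A where A: "((\<lambda>k. norm (a k) * r ^ mdeg k) has_sum A) UNIV"
    unfolding summable_on_def by blast
  have "A \<le> (1 - real CARD('n) * r) powr (- norm s)"
    using le by (intro has_sum_mono[OF A R])
  moreover have "((\<lambda>k. a k * mpow z k) has_sum ((1 - csum z) powr (- s))) UNIV"
    if "\<forall>i. norm (z $ i) \<le> r" for z :: "complex ^ 'n"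
  proof -
    have "(\<Sum>i\<in>UNIV. norm (z $ i)) \<le> (\<Sum>i\<in>(UNIV :: 'n set). r)"
      using that by (intro sum_mono) auto
    with assms have "(\<Sum>i\<in>UNIV. norm (z $ i)) < 1" by simp
    from multi_pochhammer_has_sum[OF this, of s] show ?thesis
      by (simp add: a_def csum_def mult_ac flip: mpow_div_mfact)
  qed
  ultimately show ?thesis using A by (intro has_powser_boundI[of a])
qed

section \<open>Meixner polynomials\<close>

lemma sum_UNIV_option: "(\<Sum>i\<in>UNIV. f i) = f None + (\<Sum>i\<in>UNIV. f (Some i))"
  for f :: "'a::finite option \<Rightarrow> 'b::comm_monoid_add"
  by (simp add: UNIV_option_conv sum.reindex)

lemma mult_bordered_diag:
  "(A ** bordered_diag c) $ i $ j = A $ i $ j * (case j of None \<Rightarrow> 1 | Some k \<Rightarrow> - (c $ k))"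
  by (simp add: matrix_matrix_mult_def bordered_diag_def if_distrib[of "\<lambda>x. _ * x"] cong: if_cong)

text \<open>Both arguments lie strictly between -pi/2 and pi/2, so their sum stays in the principal
  range and \<open>Ln\<close> is additive. Principal powers are not multiplicative in
  general.\<close>

lemma powr_mult_Re_pos:
  fixes u v s :: complex
  assumes "Re u > 0" "Re v > 0"
  shows "(u * v) powr s = u powr s * v powr s"
proof -
  have "u \<noteq> 0" "v \<noteq> 0" using assms by auto
  moreover have "\<bar>Im (Ln u)\<bar> < pi / 2" "\<bar>Im (Ln v)\<bar> < pi / 2"
    using assms by (simp_all only: Re_Ln_pos_lt_imp)
  ultimately have "Ln (u * v) = Ln u + Ln v"
    by (intro Ln_times_simple) auto
  thus ?thesis using \<open>u \<noteq> 0\<close> \<open>v \<noteq> 0\<close> by (simp add: powr_def distrib_left exp_add)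
qed

lemma Re_pos_if_norm_less_1: "norm v < 1 \<Longrightarrow> Re (1 - v) > 0"
  using complex_Re_le_cmod[of v] by simp

lemma sum_norm_le_polydisc:
  fixes z :: "complex ^ 'n::finite"
  assumes "\<forall>i. norm (z $ i) \<le> r"
  shows "norm (\<Sum>i\<in>UNIV. u i * z $ i) \<le> (\<Sum>i\<in>UNIV. norm (u i)) * r"
  unfolding sum_distrib_right using assms
  by (intro sum_norm_le) (auto simp: norm_mult intro: mult_left_mono)

lemma has_powser_bound_cong:
  assumes "has_powser_bound r B f" "\<And>z. \<forall>i. norm (z $ i) \<le> r \<Longrightarrow> f z = g z"
  shows "has_powser_bound r B g"
  using assms unfolding has_powser_bound_def by auto

lemma pochhammer_neq_0_if_notin_nonpos_Ints:
  "(\<beta> :: complex) \<notin> \<int>\<^sub>\<le>\<^sub>0 \<Longrightarrow> pochhammer \<beta> k \<noteq> 0"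
  by (auto simp: pochhammer_eq_0_iff)

lemma mfact_neq_0 [simp]: "mfact k \<noteq> 0"
  by (simp add: mfact_def)

text \<open>Resolves the definite description: any bounded power series of the generating function
  provides a candidate, and comparison of coefficients shows that it is the only one. The bound thus
  passes to the actual coefficients.\<close>

lemma meixner_poly_powser:
  fixes x :: "complex ^ 'n::finite"
  assumes "has_powser_bound r B (meixner_genfun \<mm> \<beta> x)" "r > 0" "\<beta> \<notin> \<int>\<^sub>\<le>\<^sub>0"
  defines "a \<equiv> \<lambda>k. pochhammer \<beta> (mdeg k) / mfact k * meixner_poly \<mm> \<beta> k x"
  obtains A where "A \<le> B" "((\<lambda>k. norm (a k) * r ^ mdeg k) has_sum A) UNIV"
    and "\<And>z. \<forall>i. norm (z $ i) \<le> r \<Longrightarrow> ((\<lambda>k. a k * mpow z k) has_sum meixner_genfun \<mm> \<beta> x z) UNIV"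
proof -
  obtain b A where b: "A \<le> B" "((\<lambda>k. norm (b k) * r ^ mdeg k) has_sum A) UNIV"
    "\<And>z. \<forall>i. norm (z $ i) \<le> r \<Longrightarrow> ((\<lambda>k. b k * mpow z k) has_sum meixner_genfun \<mm> \<beta> x z) UNIV"
    by (rule has_powser_boundE[OF assms(1)]) blast
  note nz = pochhammer_neq_0_if_notin_nonpos_Ints[OF assms(3)]
  define p where "p k = b k * mfact k / pochhammer \<beta> (mdeg k)" for k
  have p: "pochhammer \<beta> (mdeg k) / mfact k * p k = b k" for k
    using nz by (simp add: p_def)
  have "meixner_poly \<mm> \<beta> k x = p k" for k
    unfolding meixner_poly_def
  proof (subst the_equality[of _ p])
    show "\<forall>\<^sub>F z in nhds 0. ((\<lambda>k. pochhammer \<beta> (mdeg k) / mfact k * p k * mpow z k)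
             has_sum meixner_genfun \<mm> \<beta> x z) UNIV"
      unfolding p eventually_nhds_metric using b(3) \<open>r > 0\<close>
      by (intro exI[of _ r])
         (auto simp: dist_norm intro!: b(3) order.trans[OF Finite_Cartesian_Product.norm_nth_le less_imp_le])
  next
    fix q
    assume "\<forall>\<^sub>F z in nhds 0. ((\<lambda>k. pochhammer \<beta> (mdeg k) / mfact k * q k * mpow z k)
             has_sum meixner_genfun \<mm> \<beta> x z) UNIV"
    then obtain e where e: "e > 0" "\<And>z. norm z < e \<Longrightarrow>
        ((\<lambda>k. pochhammer \<beta> (mdeg k) / mfact k * q k * mpow z k) has_sum meixner_genfun \<mm> \<beta> x z) UNIV"
      unfolding eventually_nhds_metric by (auto simp: dist_norm)
    \<comment> \<open>The polydisc of radius \<delta> lies both in the polydisc of radius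
      \<open>r\<close> and in the ball of radius \<open>e\<close>, since the norm is at most the sum
      of the coordinate norms; the factor 2 makes the inequality strict.\<close>
    define \<delta> where "\<delta> = min r (e / (2 * real CARD('n)))"
    have \<delta>: "\<delta> > 0" "\<delta> \<le> r" "real CARD('n) * \<delta> < e"
    proof -
      show "\<delta> > 0" "\<delta> \<le> r" using \<open>r > 0\<close> \<open>e > 0\<close> by (auto simp: \<delta>_def)
      have "real CARD('n) * \<delta> \<le> real CARD('n) * (e / (2 * real CARD('n)))"
        unfolding \<delta>_def by (intro mult_left_mono) auto
      also have "\<dots> = e / 2" by simp
      finally show "real CARD('n) * \<delta> < e" using \<open>e > 0\<close> by simp
    qed
    have "(\<lambda>k. pochhammer \<beta> (mdeg k) / mfact k * q k) = b"
    proof (rule multi_powser_eq_imp_coeff_eq[OF \<delta>(1)])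
      fix z :: "complex ^ 'n" assume z: "\<And>i. norm (z $ i) \<le> \<delta>"
      have "norm z \<le> (\<Sum>i\<in>UNIV. norm (z $ i))" 
        unfolding norm_vec_def by (rule L2_set_le_sum) auto
      also have "\<dots> \<le> (\<Sum>i\<in>(UNIV :: 'n set). \<delta>)" by (intro sum_mono z)
      finally have "norm z < e" using \<delta>(3) by simp
      thus "((\<lambda>k. pochhammer \<beta> (mdeg k) / mfact k * q k * mpow z k) has_sum meixner_genfun \<mm> \<beta> x z) UNIV"
        by (rule e(2))
      show "((\<lambda>k. b k * mpow z k) has_sum meixner_genfun \<mm> \<beta> x z) UNIV"
        using z \<delta>(2) by (intro b(3)) (meson order.trans)
    qed
    thus "q = p"
      using nz by (auto simp: fun_eq_iff p_def field_simps)
  qed simp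
  hence "a = b" by (simp only: a_def p)
  with b show thesis by (intro that[of A]) auto
qed

section \<open>Algebraic consequences of the matrix identity\<close>

text \<open>The relations are the entries (0,0), (0,j) and (j,l) of the matrix identity, with the
  term of row 0 separated from the sum. A diagonal entry (j,j) also shows \<open>c' $ j\<close> to
  be nonzero, as \<open>c\<^sub>0\<close> is.\<close>

lemma meixner_tuple_relations:
  assumes "(c\<^sub>0, bordered_diag c, bordered_diag c', U) \<in> meixner_tuples"
  shows "c\<^sub>0 \<noteq> 0" "c' $ j \<noteq> 0" "(\<Sum>i\<in>UNIV. c $ i) = 1 - c\<^sub>0"
    and "(\<Sum>i\<in>UNIV. c $ i * U $ Some i $ Some j) = 1"
    and "(\<Sum>i\<in>UNIV. c $ i * U $ Some i $ Some j * U $ Some i $ Some l) =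
           1 + (if j = l then c\<^sub>0 / c' $ j else 0)"
proof -
  have U: "U $ None $ a = 1" "U $ a $ None = 1" for a
    using assms by (auto simp: meixner_tuples_def)
  have M: "transpose U ** bordered_diag c ** U ** bordered_diag c' = mat c\<^sub>0"
    using assms by (auto simp: meixner_tuples_def)
  show c0: "c\<^sub>0 \<noteq> 0" using assms by (auto simp: meixner_tuples_def)
  have ent: "(U $ None $ a * U $ None $ b - (\<Sum>i\<in>UNIV. c $ i * U $ Some i $ a * U $ Some i $ b))
      * (case b of None \<Rightarrow> 1 | Some k \<Rightarrow> - (c' $ k)) = (if a = b then c\<^sub>0 else 0)" for a b
  proof -
    have "(transpose U ** bordered_diag c ** U) $ a $ b =
        U $ None $ a * U $ None $ b - (\<Sum>i\<in>UNIV. c $ i * U $ Some i $ a * U $ Some i $ b)"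
      unfolding matrix_matrix_mult_def[of "transpose U ** bordered_diag c"]
      by (simp add: mult_bordered_diag sum_UNIV_option transpose_def sum_negf mult_ac)
    moreover have "(transpose U ** bordered_diag c ** U ** bordered_diag c') $ a $ b = (if a = b then c\<^sub>0 else 0)"
      unfolding M by (simp add: mat_def)
    ultimately show ?thesis by (simp add: mult_bordered_diag)
  qed
  show nz: "c' $ j \<noteq> 0" for j using ent[of "Some j" "Some j"] c0 by auto
  show "(\<Sum>i\<in>UNIV. c $ i) = 1 - c\<^sub>0"
    using ent[of None None] by (simp add: U algebra_simps)
  show "(\<Sum>i\<in>UNIV. c $ i * U $ Some i $ Some j) = 1"
    using ent[of None "Some j"] nz[of j] by (simp add: U)
  show "(\<Sum>i\<in>UNIV. c $ i * U $ Some i $ Some j * U $ Some i $ Some l) =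
           1 + (if j = l then c\<^sub>0 / c' $ j else 0)"
    using ent[of "Some j" "Some l"] nz[of l] by (auto simp: U field_simps split: if_splits)
qed

text \<open>After expansion the linear terms cancel because the weighted column sums are 1. The
  bilinear terms cancel against \<open>csum z * csum w\<close> except for the diagonal contribution
  of \<open>c\<^sub>0 / c' $ j\<close>.\<close>

lemma meixner_kernel_identity:
  fixes z w c c' :: "complex ^ 'n::finite"
  assumes "(c\<^sub>0, bordered_diag c, bordered_diag c', U) \<in> meixner_tuples"
  defines "L \<equiv> \<lambda>i z. \<Sum>j\<in>UNIV. U $ Some i $ Some j * z $ j"
  shows "(1 - csum z) * (1 - csum w) - (\<Sum>i\<in>UNIV. c $ i * (1 - L i z) * (1 - L i w)) =
         c\<^sub>0 * (1 - (\<Sum>j\<in>UNIV. z $ j * w $ j / c' $ j))"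
proof -
  note rel = meixner_tuple_relations[OF assms(1)]
  have lin: "(\<Sum>i\<in>UNIV. c $ i * L i v) = csum v" for v
  proof -
    have "(\<Sum>i\<in>UNIV. c $ i * L i v) = (\<Sum>j\<in>UNIV. (\<Sum>i\<in>UNIV. c $ i * U $ Some i $ Some j) * v $ j)"
      unfolding L_def sum_distrib_left sum_distrib_right by (subst sum.swap) (simp add: mult_ac)
    thus ?thesis by (simp add: rel(4) csum_def)
  qed
  have "(\<Sum>i\<in>UNIV. c $ i * L i z * L i w)
      = (\<Sum>i\<in>UNIV. \<Sum>j\<in>UNIV. \<Sum>l\<in>UNIV. c $ i * U $ Some i $ Some j * U $ Some i $ Some l * (z $ j * w $ l))"
    unfolding L_def mult.assoc sum_product unfolding sum_distrib_left by (simp add: mult_ac)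
  also have "\<dots> = (\<Sum>j\<in>UNIV. \<Sum>l\<in>UNIV. \<Sum>i\<in>UNIV. c $ i * U $ Some i $ Some j * U $ Some i $ Some l * (z $ j * w $ l))"
    by (subst sum.swap, rule sum.cong[OF refl], subst sum.swap, rule refl)
  also have "\<dots> = (\<Sum>j\<in>UNIV. \<Sum>l\<in>UNIV. (1 + (if j = l then c\<^sub>0 / c' $ j else 0)) * (z $ j * w $ l))"
    by (simp add: rel(5) flip: sum_distrib_right)
  also have "\<dots> = csum z * csum w + c\<^sub>0 * (\<Sum>j\<in>UNIV. z $ j * w $ j / c' $ j)"
    unfolding csum_def sum_product
    by (simp add: distrib_right sum.distrib sum_distrib_left[of c\<^sub>0] if_distrib[of "\<lambda>x. x * _"] cong: if_cong)
  finally have bil: "(\<Sum>i\<in>UNIV. c $ i * L i z * L i w)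
      = csum z * csum w + c\<^sub>0 * (\<Sum>j\<in>UNIV. z $ j * w $ j / c' $ j)" .
  have "(\<Sum>i\<in>UNIV. c $ i * (1 - L i z) * (1 - L i w))
      = (\<Sum>i\<in>UNIV. c $ i) - (\<Sum>i\<in>UNIV. c $ i * L i z) - (\<Sum>i\<in>UNIV. c $ i * L i w)
        + (\<Sum>i\<in>UNIV. c $ i * L i z * L i w)"
    by (simp add: algebra_simps sum.distrib sum_subtractf)
  thus ?thesis unfolding lin bil rel(3) by (simp add: algebra_simps)
qed

section \<open>Estimates and closed forms on a fixed polydisc\<close>

text \<open>A radius small enough for every later step: \<open>dr\<close> keeps
  \<open>1 - csum z\<close> and products of two such factors in the right half-plane,
  \<open>Kr\<close> keeps the linear factors nonzero, \<open>q\<close> makes the sum over x and its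
  majorant converge, and \<open>c'r\<close> does so for the expansion of the closed form.\<close>

locale meixner_polydisc =
  fixes c\<^sub>0 \<beta> :: complex and c c' :: "complex ^ 'n::finite" and U :: "'n cmatrix" and r :: real
  assumes tuple: "(c\<^sub>0, bordered_diag c, bordered_diag c', U) \<in> meixner_tuples"
    and \<beta>: "\<beta> \<notin> \<int>\<^sub>\<le>\<^sub>0"
    and c_less: "(\<Sum>i\<in>UNIV. norm (c $ i)) < 1"
    and r_pos: "r > 0"
    and dr: "real CARD('n) * r \<le> 1 / 4"
    and Kr: "(\<Sum>i\<in>UNIV. \<Sum>j\<in>UNIV. norm (U $ Some i $ Some j)) * r < 1"
    and q: "((1 + (\<Sum>i\<in>UNIV. \<Sum>j\<in>UNIV. norm (U $ Some i $ Some j)) * r) / (1 - real CARD('n) * r)) ^ 2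
              * (\<Sum>i\<in>UNIV. norm (c $ i)) < 1"
    and c'r: "(\<Sum>j\<in>UNIV. r ^ 2 / norm (c' $ j)) < 1"
begin

abbreviation "\<mm> \<equiv> (c\<^sub>0, bordered_diag c, bordered_diag c', U)"

definition "K = (\<Sum>i\<in>UNIV. \<Sum>j\<in>UNIV. norm (U $ Some i $ Some j))"
text \<open>Bounds the norm of \<open>(1 - L i z) / (1 - csum z)\<close> on the polydisc, hence the
  growth of the generating function per unit of degree in x. \<open>M\<close> accounts for the part
  independent of x.\<close>

definition "Q = (1 + K * r) / (1 - real CARD('n) * r)"
definition "M = (1 - real CARD('n) * r) powr (- norm \<beta>)"
definition "L i z = (\<Sum>j\<in>UNIV. U $ Some i $ Some j * z $ j)"
text \<open>The full coefficient of the monomial, Pochhammer factor included; the normalisation is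
  divided out only at the end.\<close>

definition "coef x k = pochhammer \<beta> (mdeg k) / mfact k * meixner_poly \<mm> \<beta> k (of_multiindex x)"
definition "weight x = pochhammer \<beta> (mdeg x) / mfact x * mpow c x"

abbreviation "polydisc (z :: complex ^ 'n) \<equiv> \<forall>i. norm (z $ i) \<le> r"

lemma row_sum_le_K: "(\<Sum>j\<in>UNIV. norm (U $ Some i $ Some j)) \<le> K"
  unfolding K_def by (rule member_le_sum) (auto intro: sum_nonneg)

lemma K_nonneg: "K \<ge> 0"
  unfolding K_def by (intro sum_nonneg) auto

lemma Q_less: "Q ^ 2 * (\<Sum>i\<in>UNIV. norm (c $ i)) < 1"
  using q unfolding Q_def K_def .

lemma norm_csum_le: "polydisc z \<Longrightarrow> norm (csum z) \<le> real CARD('n) * r"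
  using sum_norm_le_polydisc[of z r "\<lambda>_. 1"] by (simp add: csum_def)

lemma norm_L_le:
  assumes "polydisc z"
  shows "norm (L i z) \<le> K * r"
proof -
  have "norm (L i z) \<le> (\<Sum>j\<in>UNIV. norm (U $ Some i $ Some j)) * r"
    unfolding L_def using assms by (rule sum_norm_le_polydisc)
  also have "\<dots> \<le> K * r" using row_sum_le_K r_pos by (intro mult_right_mono) auto
  finally show ?thesis .
qed

lemma one_minus_csum_neq_0: "polydisc z \<Longrightarrow> 1 - csum z \<noteq> 0"
  using norm_csum_le[of z] dr by auto

lemma genfun_eq:
  assumes "polydisc z"
  shows "meixner_genfun \<mm> \<beta> (of_multiindex x) z =
    (1 - csum z) powr (- (\<beta> + of_nat (mdeg x))) * (\<Prod>i\<in>UNIV. (1 - L i z) ^ x i)"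
proof -
  \<comment> \<open>Nonvanishing matters for exponent 0, since \<open>0 powr 0\<close> is 0 whereas
    \<open>0 ^ 0\<close> is 1.\<close>
  have "1 - L i z \<noteq> 0" for i
    using norm_L_le[OF assms, of i] Kr by (auto simp: K_def)
  hence "(1 - L i z) powr of_nat (x i) = (1 - L i z) ^ x i" for i
    by (intro powr_nat') auto
  thus ?thesis
    by (simp add: meixner_genfun_def L_def of_multiindex_def csum_def[of "vec_lambda _"] mdeg_def)
qed

lemma has_powser_bound_genfun:
  "has_powser_bound r (M * Q ^ mdeg x) (meixner_genfun \<mm> \<beta> (of_multiindex x))"
proof -
  have d: "1 - real CARD('n) * r > 0" "1 - real CARD('n) * r \<le> 1" using dr r_pos by auto
  have "has_powser_bound r (1 + K * r) (\<lambda>z. 1 - L i z)" for i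
    unfolding L_def using r_pos row_sum_le_K
    by (intro has_powser_bound_mono[OF has_powser_bound_one_minus_linear]) (auto intro: mult_right_mono)
  hence "has_powser_bound r (\<Prod>i\<in>UNIV. (1 + K * r) ^ x i) (\<lambda>z. \<Prod>i\<in>UNIV. (1 - L i z) ^ x i)"
    using r_pos by (intro has_powser_bound_prod has_powser_bound_power) auto
  hence P: "has_powser_bound r ((1 + K * r) ^ mdeg x) (\<lambda>z. \<Prod>i\<in>UNIV. (1 - L i z) ^ x i)"
    by (simp add: mdeg_def power_sum)
  let ?s = "\<beta> + of_nat (mdeg x)"
  \<comment> \<open>The base is at most 1, so lowering the exponent by means of the triangle
    inequality for \<open>norm ?s\<close> increases the power.\<close>
  have "(1 - real CARD('n) * r) powr (- norm ?s) \<le> (1 - real CARD('n) * r) powr (- norm \<beta> - real (mdeg x))"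
    using d norm_triangle_ineq[of \<beta> "of_nat (mdeg x)"] by (intro powr_mono') auto
  also have "\<dots> = M / (1 - real CARD('n) * r) ^ mdeg x"
    using d by (simp add: powr_diff M_def powr_realpow)
  finally have "has_powser_bound r (M / (1 - real CARD('n) * r) ^ mdeg x) (\<lambda>z :: complex ^ 'n. (1 - csum z) powr (- ?s))"
    using r_pos d by (intro has_powser_bound_mono[OF has_powser_bound_one_minus_csum_powr]) auto
  from has_powser_bound_mult[OF this P r_pos] show ?thesis
    by (rule has_powser_bound_cong[OF has_powser_bound_mono])
       (simp_all add: genfun_eq Q_def power_divide)
qed

lemma coef_powser:
  obtains A where "A \<le> M * Q ^ mdeg x" "((\<lambda>k. norm (coef x k) * r ^ mdeg k) has_sum A) UNIV"
    and "\<And>z. polydisc z \<Longrightarrow>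
           ((\<lambda>k. coef x k * mpow z k) has_sum meixner_genfun \<mm> \<beta> (of_multiindex x) z) UNIV"
  by (rule meixner_poly_powser[OF has_powser_bound_genfun[of x] r_pos \<beta>])
     (rule that[unfolded coef_def])

text \<open>Once the factors independent of x are split off, what remains is the general term of the
  multivariate binomial series with parameter \<beta>.\<close>

lemma weighted_genfun_product:
  assumes "polydisc z" "polydisc w"
  shows "weight x * meixner_genfun \<mm> \<beta> (of_multiindex x) z * meixner_genfun \<mm> \<beta> (of_multiindex x) w =
    (1 - csum z) powr (- \<beta>) * (1 - csum w) powr (- \<beta>) *
    (pochhammer \<beta> (mdeg x) *
      (\<Prod>i\<in>UNIV. (c $ i * (1 - L i z) * (1 - L i w) / ((1 - csum z) * (1 - csum w))) ^ x i / fact (x i)))"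
proof -
  have *: "(1 - csum v) powr (- (\<beta> + of_nat (mdeg x))) =
      (1 - csum v) powr (- \<beta>) / (\<Prod>i\<in>UNIV. (1 - csum v) ^ x i)" if "polydisc v" for v
  proof -
    have "(1 - csum v) powr of_nat (mdeg x) = (\<Prod>i\<in>UNIV. (1 - csum v) ^ x i)"
      using one_minus_csum_neq_0[OF that] by (subst powr_nat') (auto simp: mdeg_def power_sum)
    thus ?thesis
      using powr_diff[of "1 - csum v" "- \<beta>" "of_nat (mdeg x)"] by simp
  qed
  show ?thesis
    unfolding genfun_eq[OF assms(1)] genfun_eq[OF assms(2)] *[OF assms(1)] *[OF assms(2)]
      weight_def mpow_def mfact_def
    by (simp add: power_divide power_mult_distrib prod.distrib prod_dividef mult_ac)
qed

lemma kernel_ratio_sum_norm_le: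
  assumes "polydisc z" "polydisc w"
  shows "(\<Sum>i\<in>UNIV. norm (c $ i * (1 - L i z) * (1 - L i w) / ((1 - csum z) * (1 - csum w)))) < 1"
proof -
  have d: "1 - real CARD('n) * r > 0" using dr by auto
  have L: "norm (1 - L i v) \<le> 1 + K * r" if "polydisc v" for i v
    using norm_L_le[OF that, of i] norm_triangle_ineq4[of 1 "L i v"] by simp
  have C: "norm (1 - csum v) \<ge> 1 - real CARD('n) * r" if "polydisc v" for v
    using norm_csum_le[OF that] norm_triangle_ineq2[of 1 "csum v"] by simp
  have F: "norm ((1 - L i v) / (1 - csum v)) \<le> Q" if "polydisc v" for i v
    unfolding Q_def norm_divide using L[OF that] C[OF that] d K_nonneg r_pos by (intro frac_le) auto
  have "(\<Sum>i\<in>UNIV. norm (c $ i * (1 - L i z) * (1 - L i w) / ((1 - csum z) * (1 - csum w))))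
      \<le> (\<Sum>i\<in>UNIV. Q ^ 2 * norm (c $ i))"
  proof (rule sum_mono)
    fix i
    have "norm (c $ i * (1 - L i z) * (1 - L i w) / ((1 - csum z) * (1 - csum w)))
        = norm ((1 - L i z) / (1 - csum z)) * norm ((1 - L i w) / (1 - csum w)) * norm (c $ i)"
      by (simp add: norm_mult norm_divide)
    also have "\<dots> \<le> Q * Q * norm (c $ i)"
      using F[OF assms(1), of i] F[OF assms(2), of i]
      by (intro mult_right_mono mult_mono') auto
    finally show "norm (c $ i * (1 - L i z) * (1 - L i w) / ((1 - csum z) * (1 - csum w))) \<le> Q ^ 2 * norm (c $ i)"
      by (simp add: power2_eq_square)
  qed
  also have "\<dots> < 1" using Q_less by (simp add: sum_distrib_left)
  finally show ?thesis .
qed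

lemma sum_norm_prod_div_c'_less_1:
  assumes "polydisc z" "polydisc w"
  shows "(\<Sum>j\<in>UNIV. norm (z $ j * w $ j / c' $ j)) < 1"
proof -
  have "(\<Sum>j\<in>UNIV. norm (z $ j * w $ j / c' $ j)) \<le> (\<Sum>j\<in>UNIV. r ^ 2 / norm (c' $ j))"
    using assms r_pos unfolding power2_eq_square norm_divide norm_mult
    by (intro sum_mono divide_right_mono mult_mono) auto
  thus ?thesis using c'r by simp
qed

text \<open>The kernel identity is raised to the power -\<beta>. Every base involved has positive
  real part, so the principal powers can be split factor by factor.\<close>

lemma kernel_powr:
  assumes "polydisc z" "polydisc w"
  defines "y \<equiv> \<lambda>i. c $ i * (1 - L i z) * (1 - L i w) / ((1 - csum z) * (1 - csum w))"
  shows "(1 - csum z) powr (- \<beta>) * (1 - csum w) powr (- \<beta>) * (1 - (\<Sum>i\<in>UNIV. y i)) powr (- \<beta>) =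
    c\<^sub>0 powr (- \<beta>) * (1 - (\<Sum>j\<in>UNIV. z $ j * w $ j / c' $ j)) powr (- \<beta>)"
proof -
  let ?a = "1 - csum z" and ?b = "1 - csum w"
  have small: "norm (csum z) \<le> 1 / 4" "norm (csum w) \<le> 1 / 4"
    using norm_csum_le assms(1,2) dr by (meson order.trans)+
  \<comment> \<open>Positive real parts of \<open>?a\<close> and \<open>?b\<close> do not give one
    for \<open>?a * ?b\<close>; it comes from \<open>?a * ?b\<close> being within 9/16 of 1.\<close>
  have "norm (csum z + csum w - csum z * csum w) \<le> norm (csum z) + norm (csum w) + norm (csum z) * norm (csum w)"
    using norm_triangle_ineq4[of "csum z + csum w" "csum z * csum w"] norm_triangle_ineq[of "csum z" "csum w"]
    by (simp add: norm_mult)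
  also have "\<dots> \<le> 1 / 4 + 1 / 4 + 1 / 4 * (1 / 4)"
    using small by (intro add_mono mult_mono) auto
  finally have "norm (csum z + csum w - csum z * csum w) < 1" by simp
  from Re_pos_if_norm_less_1[OF this] have ab: "Re (?a * ?b) > 0"
    by (simp add: algebra_simps)
  have a: "Re ?a > 0" and b: "Re ?b > 0"
    using small by (intro Re_pos_if_norm_less_1; linarith)+
  have "norm (\<Sum>i\<in>UNIV. y i) < 1"
    using kernel_ratio_sum_norm_le[OF assms(1,2)] norm_sum[of y UNIV] by (simp add: y_def)
  hence y: "Re (1 - (\<Sum>i\<in>UNIV. y i)) > 0" by (rule Re_pos_if_norm_less_1)
  have "norm (\<Sum>j\<in>UNIV. z $ j * w $ j / c' $ j) < 1"
    using sum_norm_prod_div_c'_less_1[OF assms(1,2)] norm_sum[of "\<lambda>j. z $ j * w $ j / c' $ j" UNIV] by simp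
  hence v: "Re (1 - (\<Sum>j\<in>UNIV. z $ j * w $ j / c' $ j)) > 0" by (rule Re_pos_if_norm_less_1)
  \<comment> \<open>Since \<open>c\<^sub>0\<close> is 1 minus this sum, it lies in the right
    half-plane.\<close>
  have "norm (\<Sum>i\<in>UNIV. c $ i) < 1"
    using c_less norm_sum[of "\<lambda>i. c $ i" UNIV] by simp
  from Re_pos_if_norm_less_1[OF this] have c0: "Re c\<^sub>0 > 0"
    unfolding meixner_tuple_relations(3)[OF tuple] by simp
  have "?a \<noteq> 0" "?b \<noteq> 0" using one_minus_csum_neq_0 assms(1,2) by auto
  hence "(?a * ?b) * (1 - (\<Sum>i\<in>UNIV. y i)) = ?a * ?b - (\<Sum>i\<in>UNIV. c $ i * (1 - L i z) * (1 - L i w))"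
    by (simp add: y_def right_diff_distrib flip: sum_divide_distrib)
  also have "\<dots> = c\<^sub>0 * (1 - (\<Sum>j\<in>UNIV. z $ j * w $ j / c' $ j))"
    unfolding L_def by (rule meixner_kernel_identity[OF tuple])
  finally have "((?a * ?b) * (1 - (\<Sum>i\<in>UNIV. y i))) powr (- \<beta>)
      = (c\<^sub>0 * (1 - (\<Sum>j\<in>UNIV. z $ j * w $ j / c' $ j))) powr (- \<beta>)" by simp
  thus ?thesis
    unfolding powr_mult_Re_pos[OF ab y] powr_mult_Re_pos[OF a b] powr_mult_Re_pos[OF c0 v] .
qed

section \<open>Summation over the lattice and interchange of sums\<close>

definition "H z w = c\<^sub>0 powr (- \<beta>) * (1 - (\<Sum>j\<in>UNIV. z $ j * w $ j / c' $ j)) powr (- \<beta>)"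

lemma weighted_genfun_product_has_sum:
  assumes "polydisc z" "polydisc w"
  shows "((\<lambda>x. weight x * meixner_genfun \<mm> \<beta> (of_multiindex x) z * meixner_genfun \<mm> \<beta> (of_multiindex x) w)
            has_sum H z w) UNIV"
  unfolding weighted_genfun_product[OF assms] H_def kernel_powr[OF assms, symmetric]
  by (intro has_sum_cmult_right multi_pochhammer_has_sum kernel_ratio_sum_norm_le assms)

text \<open>Dominates the terms of the triple series over x and the pair \<open>p\<close> of
  exponents, uniformly on the polydisc. Taking \<open>p\<close> first makes
  \<open>majorant p\<close> a family in x.\<close>

definition "majorant p x = norm (weight x) *
  ((norm (coef x (fst p)) * r ^ mdeg (fst p)) * (norm (coef x (snd p)) * r ^ mdeg (snd p)))"

text \<open>The factor \<open>Q ^ 2\<close> is absorbed into \<open>c\<close>, which leaves a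
  binomial series whose variables still have norms summing to less than 1.\<close>

lemma weight_majorant_summable:
  "(\<lambda>x. norm (weight x) * (M * Q ^ mdeg x) ^ 2) summable_on UNIV"
proof -
  have "(\<Sum>i\<in>UNIV. norm (of_real (Q ^ 2) * c $ i)) < 1"
    using Q_less by (simp add: sum_distrib_left norm_mult norm_power)
  from multi_pochhammer_abs_summable[OF this, of \<beta>]
  have "(\<lambda>x. M ^ 2 * norm (pochhammer \<beta> (mdeg x) * (\<Prod>i\<in>UNIV. (of_real (Q ^ 2) * c $ i) ^ x i / fact (x i)))) summable_on UNIV"
    by (rule summable_on_cmult_right)
  moreover have "M ^ 2 * norm (pochhammer \<beta> (mdeg x) * (\<Prod>i\<in>UNIV. (of_real (Q ^ 2) * c $ i) ^ x i / fact (x i)))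
      = norm (weight x) * (M * Q ^ mdeg x) ^ 2" for x
  proof -
    have "(\<Prod>i\<in>UNIV. (of_real (Q ^ 2) * c $ i) ^ x i / fact (x i)) = of_real ((Q ^ 2) ^ mdeg x) * mpow c x / mfact x"
      by (simp add: power_mult_distrib prod.distrib prod_dividef mpow_def mfact_def mdeg_def power_sum)
    thus ?thesis
      by (simp add: weight_def norm_mult norm_divide norm_power power_mult_distrib power_even_abs mult_ac
          flip: power_mult)
  qed
  ultimately show ?thesis by simp
qed

text \<open>For fixed x the sum over pairs of exponents is the square of the absolute series of the
  generating function, at most \<open>(M * Q ^ mdeg x) ^ 2\<close>.\<close>

lemma majorant_summable: "(\<lambda>(x, p). majorant p x) summable_on UNIV \<times> UNIV"
proof -
  define A where "A x = infsum (\<lambda>k. norm (coef x k) * r ^ mdeg k) UNIV" for x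
  have A: "((\<lambda>k. norm (coef x k) * r ^ mdeg k) has_sum A x) UNIV" "A x \<le> M * Q ^ mdeg x" for x
  proof -
    obtain A' where "A' \<le> M * Q ^ mdeg x" "((\<lambda>k. norm (coef x k) * r ^ mdeg k) has_sum A') UNIV"
      by (rule coef_powser)
    thus "((\<lambda>k. norm (coef x k) * r ^ mdeg k) has_sum A x) UNIV" "A x \<le> M * Q ^ mdeg x"
      using infsumI unfolding A_def by auto
  qed
  have A0: "A x \<ge> 0" for x using A(1) r_pos by (intro has_sum_nonneg[OF A(1)]) auto
  show ?thesis
  proof (rule summable_on_SigmaI)
    fix x
    have "((\<lambda>(k, l). complex_of_real (norm (coef x k) * r ^ mdeg k) * of_real (norm (coef x l) * r ^ mdeg l))
            has_sum (of_real (A x) * of_real (A x))) (UNIV \<times> UNIV)"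
      by (intro has_sum_mult_complex has_sum_of_real A)
    hence "((\<lambda>p. complex_of_real ((norm (coef x (fst p)) * r ^ mdeg (fst p)) * (norm (coef x (snd p)) * r ^ mdeg (snd p))))
            has_sum of_real (A x * A x)) UNIV"
      by (simp add: case_prod_unfold)
    hence "((\<lambda>p. (norm (coef x (fst p)) * r ^ mdeg (fst p)) * (norm (coef x (snd p)) * r ^ mdeg (snd p)))
            has_sum (A x * A x)) UNIV"
      by (subst (asm) has_sum_of_real_iff)
    from has_sum_cmult_right[OF this, of "norm (weight x)"]
    show "((\<lambda>p. case (x, p) of (x, p) \<Rightarrow> majorant p x) has_sum (norm (weight x) * (A x * A x))) UNIV"
      by (simp add: majorant_def)
  next
    show "(\<lambda>x. norm (weight x) * (A x * A x)) summable_on UNIV"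
    proof (rule summable_on_comparison_test[OF weight_majorant_summable])
      fix x
      have "A x * A x \<le> (M * Q ^ mdeg x) ^ 2"
        unfolding power2_eq_square using A(2)[of x] A0[of x] by (intro mult_mono) auto
      thus "norm (weight x) * (A x * A x) \<le> norm (weight x) * (M * Q ^ mdeg x) ^ 2"
        by (rule mult_left_mono) simp
    qed (use A0 in auto)
  qed (use r_pos in \<open>auto simp: majorant_def\<close>)
qed

section \<open>Moments and comparison of coefficients\<close>

definition "moment k l = infsum (\<lambda>x. weight x * coef x k * coef x l) UNIV"

lemma moment_has_sum: "((\<lambda>x. weight x * coef x k * coef x l) has_sum moment k l) UNIV"
proof -
  have "(\<lambda>(p, x). majorant p x) summable_on UNIV \<times> UNIV"
    using majorant_summable by (subst summable_on_swap) (simp add: case_prod_unfold)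
  hence "majorant (k, l) summable_on UNIV" by (rule summable_on_SigmaD1) auto
  also have "majorant (k, l) = (\<lambda>x. norm (weight x * coef x k * coef x l) * (r ^ mdeg k * r ^ mdeg l))"
    by (simp add: majorant_def fun_eq_iff norm_mult)
  finally have "(\<lambda>x. norm (weight x * coef x k * coef x l) * (r ^ mdeg k * r ^ mdeg l)) summable_on UNIV" .
  hence "(\<lambda>x. norm (weight x * coef x k * coef x l)) summable_on UNIV"
    using r_pos by (subst (asm) summable_on_cmult_left') auto
  thus ?thesis unfolding moment_def by (intro has_sum_infsum) (rule Infinite_Sum.abs_summable_summable)
qed

text \<open>The triple series is summed in two orders. Exponents first give the product of two
  generating functions and then \<open>H z w\<close>; x first gives the moments.\<close>

lemma moment_genfun:
  assumes z: "polydisc z" and w: "polydisc w"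
  shows "((\<lambda>(k, l). moment k l * mpow z k * mpow w l) has_sum H z w) (UNIV \<times> UNIV)"
proof -
  define F where "F x p = weight x * ((coef x (fst p) * mpow z (fst p)) * (coef x (snd p) * mpow w (snd p)))" for x p
  have le: "norm (F x p) \<le> majorant p x" for x p
    unfolding F_def majorant_def norm_mult
    using norm_mpow_le[OF z] norm_mpow_le[OF w] r_pos by (intro mult_left_mono mult_mono) auto
  have "(\<lambda>q. norm (case q of (x, p) \<Rightarrow> F x p)) summable_on UNIV \<times> UNIV"
    using le by (intro summable_on_comparison_test[OF majorant_summable]) auto
  hence sm: "(\<lambda>(x, p). F x p) summable_on UNIV \<times> UNIV"
    by (rule Infinite_Sum.abs_summable_summable)
  have inner: "(F x has_sum (weight x * meixner_genfun \<mm> \<beta> (of_multiindex x) z * meixner_genfun \<mm> \<beta> (of_multiindex x) w)) UNIV" for x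
  proof -
    have G: "((\<lambda>k. coef x k * mpow v k) has_sum meixner_genfun \<mm> \<beta> (of_multiindex x) v) UNIV" if "polydisc v" for v
      by (rule coef_powser[of x]) (use that in auto)
    from has_sum_cmult_right[OF has_sum_mult_complex[OF G[OF z] G[OF w]], of "weight x"]
    show ?thesis by (simp add: F_def[abs_def] case_prod_unfold mult.assoc)
  qed
  have "((\<lambda>(x, p). F x p) has_sum H z w) (UNIV \<times> UNIV)"
    by (rule has_sum_SigmaI[OF _ weighted_genfun_product_has_sum[OF z w] sm]) (use inner in simp)
  hence "((\<lambda>(p, x). F x p) has_sum H z w) (UNIV \<times> UNIV)"
    by (subst has_sum_swap) (simp add: case_prod_unfold)
  hence "((\<lambda>p. moment (fst p) (snd p) * (mpow z (fst p) * mpow w (snd p))) has_sum H z w) UNIV"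
  proof (rule has_sum_SigmaD)
    fix p :: "('n \<Rightarrow> nat) \<times> ('n \<Rightarrow> nat)"
    show "((\<lambda>x. case (p, x) of (p, x) \<Rightarrow> F x p) has_sum
            moment (fst p) (snd p) * (mpow z (fst p) * mpow w (snd p))) UNIV"
      using has_sum_cmult_left[OF moment_has_sum[of "fst p" "snd p"], of "mpow z (fst p) * mpow w (snd p)"]
      by (simp add: F_def mult_ac)
  qed
  thus ?thesis by (simp add: case_prod_unfold mult.assoc)
qed

text \<open>The powers of \<open>w\<close> are kept in the coefficient, so that for fixed
  \<open>w\<close> this is a power series in \<open>z\<close> alone.\<close>

lemma H_powser:
  assumes "polydisc z" "polydisc w"
  shows "((\<lambda>k. (c\<^sub>0 powr (- \<beta>) * (pochhammer \<beta> (mdeg k) / mfact k) / mpow c' k * mpow w k) * mpow z k) has_sum H z w) UNIV"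
proof -
  have "(\<Prod>i\<in>UNIV. (z $ i * w $ i / c' $ i) ^ k i / fact (k i)) = mpow z k * mpow w k / (mpow c' k * mfact k)" for k
    by (simp add: power_divide power_mult_distrib prod.distrib prod_dividef mpow_def mfact_def)
  with has_sum_cmult_right[OF multi_pochhammer_has_sum[OF sum_norm_prod_div_c'_less_1[OF assms], of \<beta>], of "c\<^sub>0 powr (- \<beta>)"]
  show ?thesis by (simp add: H_def mult_ac)
qed

text \<open>Uniqueness of coefficients is used twice: in \<open>z\<close> for fixed
  \<open>w\<close>, which identifies the row sums, and then in \<open>w\<close> for a fixed
  row.\<close>

lemma moment_eq:
  "moment k l = (if k = l then c\<^sub>0 powr (- \<beta>) * (pochhammer \<beta> (mdeg k) / mfact k) / mpow c' k else 0)"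
proof -
  define h where "h k = c\<^sub>0 powr (- \<beta>) * (pochhammer \<beta> (mdeg k) / mfact k) / mpow c' k" for k
  have row: "((\<lambda>l. moment k l * mpow w l) has_sum (h k * mpow w k)) UNIV" if w: "polydisc w" for k w
  proof -
    \<comment> \<open>All monomials are nonzero at this point, so its factor cancels and each row is
      summable on its own.\<close>
    define z0 :: "complex ^ 'n" where "z0 = (\<chi> i. of_real r)"
    have "polydisc z0" using r_pos by (simp add: z0_def)
    hence "(\<lambda>(k, l). moment k l * mpow z0 k * mpow w l) summable_on UNIV \<times> UNIV"
      by (intro has_sum_imp_summable[OF moment_genfun] w)
    hence "(\<lambda>l. moment k l * mpow z0 k * mpow w l) summable_on UNIV" for k
      by (rule summable_on_SigmaD1) auto
    hence "(\<lambda>l. mpow z0 k * (moment k l * mpow w l)) summable_on UNIV" for k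
      by (simp add: mult_ac)
    moreover have "mpow z0 k \<noteq> 0" for k using r_pos by (simp add: z0_def mpow_def)
    ultimately have sm: "(\<lambda>l. moment k l * mpow w l) summable_on UNIV" for k
      by (subst (asm) summable_on_cmult_right') auto
    define g where "g k = infsum (\<lambda>l. moment k l * mpow w l) UNIV" for k
    have g: "((\<lambda>l. moment k l * mpow w l) has_sum g k) UNIV" for k
      unfolding g_def using sm by (rule has_sum_infsum)
    have "((\<lambda>k. g k * mpow z k) has_sum H z w) UNIV" if z: "polydisc z" for z
    proof (rule has_sum_SigmaD[OF moment_genfun[OF z w]])
      fix k
      show "((\<lambda>l. case (k, l) of (k, l) \<Rightarrow> moment k l * mpow z k * mpow w l) has_sum g k * mpow z k) UNIV"
        using has_sum_cmult_left[OF g[of k], of "mpow z k"] by (simp add: mult_ac)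
    qed
    hence "g = (\<lambda>k. h k * mpow w k)"
      unfolding h_def using H_powser w by (intro multi_powser_eq_imp_coeff_eq[OF r_pos]) auto
    with g show ?thesis by simp
  qed
  have "moment k = (\<lambda>l. if k = l then h k else 0)"
  proof (rule multi_powser_eq_imp_coeff_eq[OF r_pos])
    fix w :: "complex ^ 'n" assume w: "\<And>i. norm (w $ i) \<le> r"
    show "((\<lambda>l. moment k l * mpow w l) has_sum (h k * mpow w k)) UNIV" using w by (intro row) auto
    show "((\<lambda>l. (if k = l then h k else 0) * mpow w l) has_sum (h k * mpow w k)) UNIV"
      by (rule has_sum_finite_neutralI[of "{k}"]) auto
  qed
  thus ?thesis by (simp add: h_def)
qed

text \<open>Dividing the moments by both normalising factors leaves one inverse factor on the
  diagonal, which produces \<open>mfact n\<close> over the Pochhammer symbol.\<close>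

lemma meixner_orthogonality:
  "((\<lambda>x. meixner_poly \<mm> \<beta> n (of_multiindex x) * meixner_poly \<mm> \<beta> m (of_multiindex x) *
      (pochhammer \<beta> (mdeg x) / mfact x) * mpow c x)
    has_sum (c\<^sub>0 powr (- \<beta>) * mfact n / (pochhammer \<beta> (mdeg n) * mpow c' n) * (if n = m then 1 else 0))) UNIV"
proof -
  note nz = pochhammer_neq_0_if_notin_nonpos_Ints[OF \<beta>]
  let ?\<kappa> = "\<lambda>k. pochhammer \<beta> (mdeg k) / mfact k"
  from has_sum_cmult_left[OF moment_has_sum[of n m], of "inverse (?\<kappa> n * ?\<kappa> m)"]
  have "((\<lambda>x. weight x * coef x n * coef x m * inverse (?\<kappa> n * ?\<kappa> m)) has_sum
          (moment n m * inverse (?\<kappa> n * ?\<kappa> m))) UNIV" .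
  moreover have "weight x * coef x n * coef x m * inverse (?\<kappa> n * ?\<kappa> m) =
      meixner_poly \<mm> \<beta> n (of_multiindex x) * meixner_poly \<mm> \<beta> m (of_multiindex x) *
      (pochhammer \<beta> (mdeg x) / mfact x) * mpow c x" for x
    using nz by (simp add: weight_def coef_def field_simps)
  moreover have "moment n m * inverse (?\<kappa> n * ?\<kappa> m) =
      c\<^sub>0 powr (- \<beta>) * mfact n / (pochhammer \<beta> (mdeg n) * mpow c' n) * (if n = m then 1 else 0)"
    using nz by (simp add: moment_eq field_simps)
  ultimately show ?thesis by simp
qed

end

section \<open>Choice of the radius and conclusion\<close>

text \<open>As \<open>r\<close> tends to 0 from the right, the bounded expressions tend to 0, except
  for the one with \<open>Q\<close>, which tends to the sum of the norms of the
  \<open>c $ i\<close>. All limits lie strictly below the required bounds, so every small positive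
  \<open>r\<close> works.\<close>

lemma meixner_polydisc_exists:
  fixes c c' :: "complex ^ 'n::finite"
  assumes "(c\<^sub>0, bordered_diag c, bordered_diag c', U) \<in> meixner_tuples"
    and "\<beta> \<notin> \<int>\<^sub>\<le>\<^sub>0" and "(\<Sum>i\<in>UNIV. norm (c $ i)) < 1"
  obtains r where "meixner_polydisc c\<^sub>0 \<beta> c c' U r"
proof -
  define K where "K = (\<Sum>i\<in>UNIV. \<Sum>j\<in>UNIV. norm (U $ Some i $ Some j))"
  define N where "N = (\<Sum>i\<in>UNIV. norm (c $ i))"
  have lim: "((\<lambda>r. real CARD('n) * r) \<longlongrightarrow> real CARD('n) * 0) (at_right 0)"
    "((\<lambda>r. K * r) \<longlongrightarrow> K * 0) (at_right 0)"
    "((\<lambda>r. ((1 + K * r) / (1 - real CARD('n) * r)) ^ 2 * N) \<longlongrightarrow> ((1 + K * 0) / (1 - real CARD('n) * 0)) ^ 2 * N) (at_right 0)"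
    "((\<lambda>r. \<Sum>j\<in>UNIV. r ^ 2 / norm (c' $ j)) \<longlongrightarrow> (\<Sum>j\<in>UNIV. 0 ^ 2 / norm (c' $ j))) (at_right 0)"
    by (intro tendsto_intros; simp add: meixner_tuple_relations(2)[OF assms(1)])+
  have "\<forall>\<^sub>F r in at_right 0. real CARD('n) * r < 1 / 4" "\<forall>\<^sub>F r in at_right 0. K * r < 1"
    "\<forall>\<^sub>F r in at_right 0. ((1 + K * r) / (1 - real CARD('n) * r)) ^ 2 * N < 1"
    "\<forall>\<^sub>F r in at_right 0. (\<Sum>j\<in>UNIV. r ^ 2 / norm (c' $ j)) < 1"
    using assms(3) by (intro order_tendstoD(2)[OF lim(1)] order_tendstoD(2)[OF lim(2)]
        order_tendstoD(2)[OF lim(3)] order_tendstoD(2)[OF lim(4)]; simp add: N_def)+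
  moreover have "\<forall>\<^sub>F r in at_right (0 :: real). r > 0" by (rule eventually_at_right_less)
  ultimately have "\<forall>\<^sub>F r in at_right 0. meixner_polydisc c\<^sub>0 \<beta> c c' U r"
    by eventually_elim (use assms in \<open>unfold_locales; simp add: K_def N_def\<close>)
  from eventually_happens'[OF _ this] that show thesis by auto
qed

theorem theorem2p4:
  fixes c\<^sub>0 \<beta> :: complex
    and c c' :: "complex ^ 'n::finite"
    and U :: "'n cmatrix"
    and \<mm> :: "'n meixner_tuple"
    and n m :: "'n \<Rightarrow> nat"
  assumes "\<mm> = (c\<^sub>0, bordered_diag c, bordered_diag c', U)"
    and "\<mm> \<in> meixner_tuples"
    and "\<beta> \<notin> \<int>\<^sub>\<le>\<^sub>0"
    and "(\<Sum>i\<in>UNIV. norm (c $ i)) < 1"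
  shows "((\<lambda>x. meixner_poly \<mm> \<beta> n (of_multiindex x) * meixner_poly \<mm> \<beta> m (of_multiindex x) *
             (pochhammer \<beta> (mdeg x) / mfact x) * mpow c x)
           has_sum
           (c\<^sub>0 powr (- \<beta>) * mfact n / (pochhammer \<beta> (mdeg n) * mpow c' n) *
             (if n = m then 1 else 0))) UNIV"
proof -
  from assms obtain r where "meixner_polydisc c\<^sub>0 \<beta> c c' U r"
    by (auto intro: meixner_polydisc_exists)
  then interpret meixner_polydisc c\<^sub>0 \<beta> c c' U r .
  show ?thesis unfolding assms(1) by (rule meixner_orthogonality)
qed

end
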